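(* Let $p$ be an odd prime and let $q$ be a prime and $s \geq 1$. Let $N(q^s)$ be the number of pairs $(a,b) \in (\mathbb{Z}/q^s\mathbb{Z})^2$ with $$\sum_{k=0}^{p}\binom{p}{k} 2^{\lfloor k/2 \rfloor} a^{p-k} b^k \equiv 1 \pmod{q^s}.$$ Then: (1) $N(q^s) = q^s$ if any of the following holds: (a) $q \notin \{p, 2\}$ and $q \not\equiv \pm 1 \pmod p$; (b) $q \equiv -1 \pmod p$ and $\left(\frac{2}{q}\right) = 1$; (c) $(q,s) = (p,1)$. (2) If $q \equiv -1 \pmod p$ and $\left(\frac{2}{q}\right) = -1$, then $N(q^s) = q^s + q^{s-1}$ when $1+\sqrt{2}$ is not a $p$th power in $\mathbb{F}_q(\sqrt{2})$, and $N(q^s) = q^s + (1-p)q^{s-1}$ when $1+\sqrt{2}$ is a $p$th power in $\mathbb{F}_q(\sqrt{2})$. (3) If $q = 2$, then $N(q^s) = 2^{s-1}$. (4) If $q \equiv 1 \pmod p$, or $q = p$ and $s > 1$, then $N(q^s) = p q^{s-1} d$ for some positive integer $d$ depending only on $p$ and $q$.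
   Context: $\left(\frac{2}{q}\right)$ is the Legendre symbol; $\mathbb{F}_q(\sqrt{2})$ is the field obtained by adjoining a square root of $2$ to the finite field $\mathbb{F}_q$. *)

theory Defs
  imports "HOL-Number_Theory.Number_Theory"
begin

definition form_F :: "nat \<Rightarrow> int \<Rightarrow> int \<Rightarrow> int" where
  "form_F p a b = (\<Sum>k=0..p. int (p choose k) * 2 ^ (k div 2) * a ^ (p - k) * b ^ k)"

definition N_count :: "nat \<Rightarrow> nat \<Rightarrow> nat" where
  "N_count p m = card {(a::int, b::int). 0 \<le> a \<and> a < int m \<and> 0 \<le> b \<and> b < int m \<and>
                     [form_F p a b = 1] (mod int m)}"

text \<open>Arithmetic in F_q(sqrt 2) = F_q[t]/(t^2-2): the pair (x,y) stands for x + y sqrt 2,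
  coordinates reduced mod q.\<close>
definition qs2_mult :: "int \<Rightarrow> int \<times> int \<Rightarrow> int \<times> int \<Rightarrow> int \<times> int" where
  "qs2_mult q z w = ((fst z * fst w + 2 * snd z * snd w) mod q,
                     (fst z * snd w + snd z * fst w) mod q)"

fun qs2_pow :: "int \<Rightarrow> int \<times> int \<Rightarrow> nat \<Rightarrow> int \<times> int" where
  "qs2_pow q z 0 = (1 mod q, 0)"
| "qs2_pow q z (Suc n) = qs2_mult q z (qs2_pow q z n)"

definition one_plus_sqrt2_is_pth_power :: "nat \<Rightarrow> nat \<Rightarrow> bool" where
  "one_plus_sqrt2_is_pth_power n q \<longleftrightarrow>
     (\<exists>x y. qs2_pow (int q) (x, y) n = (1 mod int q, 1 mod int q))"

end

theory Submission
  imports Defs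
begin

text \<open>
  Writing z = a + b sqrt 2, the form is l (z ^ p), where l is the linear functional on Z[sqrt 2]
  summing the two coordinates.  Expanding l ((z + h w) ^ p) in h shows that the derivative at z
  is w \<mapsto> p l (z ^ (p - 1) w), which takes the value p l (z ^ p) at w = z; hence solutions are
  nonsingular (up to the factor p when q = p) and each of them lifts in exactly q ways, which
  reduces everything to s = 1 (or s = 2 if q = p).

  Modulo an odd prime q \<noteq> p, Frobenius gives z ^ (q^2) = z, and z ^ q = z if 2 is a square.
  If p is prime to the exponent in question, z \<mapsto> z ^ p permutes the residues, so the
  solutions biject with a line.  If q is 1 modulo p, multiplication by p-th roots of unity acts
  freely on the solutions.  If 2 is not a square and p divides q + 1, scaling by the units of F_q
  shows that l (z ^ p) takes all nonzero values equally often, so it remains to count the zeros of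
  l (z ^ p); these are the z with z ^ p on the line through sqrt 2 - 1, the inverse of 1 + sqrt 2.
\<close>

section \<open>The ring Z[sqrt 2]\<close>

text \<open>A type of its own over the integers, so that it can be an instance of
  \<open>comm_ring_1\<close> and one ring serves every modulus; reduction enters only through
  \<open>zcong\<close> and \<open>zred\<close>.\<close>

datatype zsqrt2 = ZS (zre: int) (zim: int)

instantiation zsqrt2 :: comm_ring_1
begin
definition zero_zsqrt2 where "0 = ZS 0 0"
definition one_zsqrt2 where "1 = ZS 1 0"
definition plus_zsqrt2 where "z + w = ZS (zre z + zre w) (zim z + zim w)"
definition minus_zsqrt2 where "z - w = ZS (zre z - zre w) (zim z - zim w)"
definition uminus_zsqrt2 where "- z = ZS (- zre z) (- zim z)"
definition times_zsqrt2 where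
  "z * w = ZS (zre z * zre w + 2 * zim z * zim w) (zre z * zim w + zim z * zre w)"
instance
  by standard
    (auto simp: zero_zsqrt2_def one_zsqrt2_def plus_zsqrt2_def minus_zsqrt2_def
      uminus_zsqrt2_def times_zsqrt2_def algebra_simps zsqrt2.expand)
end

lemma zsqrt2_sel [simp]:
  "zre 0 = 0" "zim 0 = 0" "zre 1 = 1" "zim 1 = 0"
  "zre (z + w) = zre z + zre w" "zim (z + w) = zim z + zim w"
  "zre (z - w) = zre z - zre w" "zim (z - w) = zim z - zim w"
  "zre (- z) = - zre z" "zim (- z) = - zim z"
  "zre (z * w) = zre z * zre w + 2 * zim z * zim w"
  "zim (z * w) = zre z * zim w + zim z * zre w"
  by (simp_all add: zero_zsqrt2_def one_zsqrt2_def plus_zsqrt2_def minus_zsqrt2_def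
      uminus_zsqrt2_def times_zsqrt2_def)

lemma zsqrt2_of_nat_sel [simp]: "zre (of_nat n) = int n" "zim (of_nat n) = 0"
  by (induction n) auto

lemma zsqrt2_of_int_sel [simp]: "zre (of_int n) = n" "zim (of_int n) = 0"
  by (cases n rule: int_cases2; simp)+

lemma zsqrt2_sum_sel: "zre (\<Sum>i\<in>A. f i) = (\<Sum>i\<in>A. zre (f i))"
    "zim (\<Sum>i\<in>A. f i) = (\<Sum>i\<in>A. zim (f i))"
  by (induction A rule: infinite_finite_induct; simp)+

abbreviation root2 :: zsqrt2 where "root2 \<equiv> ZS 0 1"

lemma ZS_conv: "ZS a b = of_int a + of_int b * root2"
  by (simp add: zsqrt2.expand)

lemma root2_power2: "root2 ^ 2 = 2"
proof -
  have "zre 2 = 2" "zim 2 = 0"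
    using zsqrt2_of_int_sel[of 2] by simp_all
  thus ?thesis by (simp add: zsqrt2.expand power2_eq_square)
qed

section \<open>The form as a linear functional of a p-th power\<close>

definition coeff_sum :: "zsqrt2 \<Rightarrow> int" where
  "coeff_sum z = zre z + zim z"

lemma coeff_sum_scale: "coeff_sum (of_int n * z) = n * coeff_sum z"
  by (simp add: coeff_sum_def algebra_simps)

lemma coeff_sum_sum: "coeff_sum (\<Sum>i\<in>A. f i) = (\<Sum>i\<in>A. coeff_sum (f i))"
  by (simp add: coeff_sum_def zsqrt2_sum_sel sum.distrib)

lemma root2_power_even: "root2 ^ (2 * k) = of_int (2 ^ k)"
  by (simp add: power_mult root2_power2)

text \<open>Exactly one coordinate of \<open>root2 ^ k\<close> is nonzero, the first or the second
  according to the parity of \<open>k\<close>. This is the source of the floor in the exponent of 2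
  in the form.\<close>

lemma coeff_sum_root2_power: "coeff_sum (root2 ^ k) = 2 ^ (k div 2)"
proof (cases "even k")
  case True
  then obtain j where "k = 2 * j" by blast
  thus ?thesis by (simp add: root2_power_even coeff_sum_def del: of_int_power)
next
  case False
  then obtain j where j: "k = 2 * j + 1" using oddE by blast
  hence "root2 ^ k = root2 ^ (2 * j) * root2" by simp
  hence "root2 ^ k = of_int (2 ^ j) * root2" by (simp only: root2_power_even)
  thus ?thesis using j by (simp add: coeff_sum_def del: of_int_power)
qed

lemma form_F_eq_coeff_sum: "form_F p a b = coeff_sum (ZS a b ^ p)"
proof -
  have "ZS a b ^ p = (of_int b * root2 + of_int a) ^ p"
    by (simp only: ZS_conv[of a b] add.commute)
  also have "\<dots> = (\<Sum>k\<le>p. of_nat (p choose k) * (of_int b * root2) ^ k * of_int a ^ (p - k))"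
    by (rule binomial_ring)
  \<comment> \<open>All integer factors are gathered into one scalar, so that the functional is
    evaluated only on powers of \<open>root2\<close>.\<close>
  also have "\<dots> = (\<Sum>k\<le>p. of_int (int (p choose k) * a ^ (p - k) * b ^ k) * root2 ^ k)"
    by (intro sum.cong) (auto simp: power_mult_distrib algebra_simps)
  finally have "coeff_sum (ZS a b ^ p) =
      (\<Sum>k\<le>p. int (p choose k) * a ^ (p - k) * b ^ k * 2 ^ (k div 2))"
    by (simp only: coeff_sum_sum coeff_sum_scale coeff_sum_root2_power)
  thus ?thesis by (simp add: form_F_def atMost_atLeast0 mult_ac)
qed

section \<open>Congruence in Z[sqrt 2] modulo an integer\<close>

definition zcong :: "int \<Rightarrow> zsqrt2 \<Rightarrow> zsqrt2 \<Rightarrow> bool" where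
  "zcong m z w \<longleftrightarrow> [zre z = zre w] (mod m) \<and> [zim z = zim w] (mod m)"

text \<open>Links the coordinatewise form, suited to computation, with divisibility in the ring,
  suited to binomial and telescoping arguments.\<close>

lemma zcong_iff_dvd: "zcong m z w \<longleftrightarrow> of_int m dvd z - w"
proof
  assume "zcong m z w"
  then obtain x y where "zre z - zre w = m * x" "zim z - zim w = m * y"
    unfolding zcong_def cong_iff_dvd_diff dvd_def by blast
  hence "z - w = of_int m * ZS x y" by (simp add: zsqrt2.expand)
  thus "of_int m dvd z - w" by simp
next
  assume "of_int m dvd z - w"
  then obtain v where v: "z - w = of_int m * v" by blast
  have "zre z - zre w = m * zre v" "zim z - zim w = m * zim v"
    using arg_cong[OF v, of zre] arg_cong[OF v, of zim] by simp_all
  thus "zcong m z w" by (simp add: zcong_def cong_iff_dvd_diff)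
qed

lemma zcong_refl [simp, intro]: "zcong m z z"
  by (simp add: zcong_def)

lemma zcong_sym: "zcong m z w \<Longrightarrow> zcong m w z"
  by (simp add: zcong_def cong_sym)

lemma zcong_trans [trans]: "zcong m z w \<Longrightarrow> zcong m w v \<Longrightarrow> zcong m z v"
  unfolding zcong_def using cong_trans by blast

lemma zcong_eq_trans [trans]:
  "zcong m z w \<Longrightarrow> w = v \<Longrightarrow> zcong m z v" "z = w \<Longrightarrow> zcong m w v \<Longrightarrow> zcong m z v"
  by simp_all

lemma zcong_add: "zcong m z z' \<Longrightarrow> zcong m w w' \<Longrightarrow> zcong m (z + w) (z' + w')"
  by (simp add: zcong_def cong_add)

lemma zcong_mult: "zcong m z z' \<Longrightarrow> zcong m w w' \<Longrightarrow> zcong m (z * w) (z' * w')"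
  by (simp add: zcong_def cong_add cong_mult)

lemma zcong_power: "zcong m z w \<Longrightarrow> zcong m (z ^ n) (w ^ n)"
  by (induction n) (auto intro: zcong_mult)

lemma zcong_of_int_iff: "zcong m (of_int a) (of_int b) \<longleftrightarrow> [a = b] (mod m)"
  by (simp add: zcong_def)

lemma zcong_coeff_sum: "zcong m z w \<Longrightarrow> [coeff_sum z = coeff_sum w] (mod m)"
  by (simp add: zcong_def coeff_sum_def cong_add)

section \<open>The Frobenius map\<close>

lemma dvd_freshmans_dream:
  fixes x y :: "'a::comm_ring_1"
  assumes "prime q"
  shows "of_nat q dvd (x + y) ^ q - (x ^ q + y ^ q)"
proof -
  have q: "q > 0" using assms prime_gt_0_nat by blast
  let ?f = "\<lambda>k. of_nat (q choose k) * x ^ k * y ^ (q - k)"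
  have "{..q} = insert 0 (insert q {0<..<q})" using q by auto
  hence "(\<Sum>k\<le>q. ?f k) = y ^ q + x ^ q + (\<Sum>k\<in>{0<..<q}. ?f k)"
    using q by (simp add: algebra_simps)
  hence "(x + y) ^ q - (x ^ q + y ^ q) = (\<Sum>k\<in>{0<..<q}. ?f k)"
    by (simp add: binomial_ring)
  moreover have "of_nat q dvd ?f k" if k: "k \<in> {0<..<q}" for k
  proof -
    obtain j where "q choose k = q * j"
      using k q assms dvd_choose_prime[of k q] by (auto elim: dvdE)
    thus ?thesis by (simp add: mult.assoc)
  qed
  ultimately show ?thesis by (simp only:) (rule dvd_sum)
qed

text \<open>In this form Fermat's theorem covers multiples of \<open>q\<close> as well; it is
  carried from naturals to integers by the nonnegative residue of \<open>a\<close>.\<close>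

lemma fermat_cong_int:
  assumes "prime q"
  shows "[a ^ q = a] (mod int q)"
proof -
  have q: "q > 0" using assms prime_gt_0_nat by blast
  define n where "n = nat (a mod int q)"
  have n: "[a = int n] (mod int q)" using q by (simp add: n_def cong_def)
  have "[n ^ q = n] (mod q)"
  proof (cases "q dvd n")
    case True
    hence "q dvd n ^ q" using q by (meson dvd_power dvd_trans)
    thus ?thesis using True by (simp add: cong_def)
  next
    case False
    have "[n ^ (q - 1) * n = 1 * n] (mod q)"
      using fermat_theorem[OF assms False] cong_scalar_right by blast
    moreover have "n ^ (q - 1) * n = n ^ q" using q by (metis power_minus_mult)
    ultimately show ?thesis by simp
  qed
  hence "[int n ^ q = int n] (mod int q)"
    by (metis cong_int_iff of_nat_power)
  thus ?thesis using n by (meson cong_pow cong_sym cong_trans)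
qed

text \<open>For odd \<open>q\<close>, the power \<open>root2 ^ q\<close> is \<open>root2\<close>
  times 2 to the power \<open>(q - 1) div 2\<close>. By Euler's criterion this factor is the
  Legendre symbol of 2, so Frobenius is the identity if 2 is a nonzero square and conjugation if 2
  is not a square.\<close>

lemma zcong_frobenius:
  assumes "prime q" "odd q"
  shows "zcong (int q) (z ^ q) (ZS (zre z) (2 ^ ((q - 1) div 2) * zim z))"
proof -
  let ?a = "zre z" and ?b = "zim z"
  have z: "z = of_int ?a + of_int ?b * root2"
    using ZS_conv[of ?a ?b] by simp
  have "zcong (int q) (z ^ q) (of_int ?a ^ q + (of_int ?b * root2) ^ q)"
    unfolding zcong_iff_dvd using dvd_freshmans_dream[OF assms(1), of "of_int ?a" "of_int ?b * root2"]
    by (simp flip: z)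
  also have "(of_int ?b * root2) ^ q = of_int (?b ^ q) * (of_int (2 ^ ((q - 1) div 2)) * root2)"
  proof -
    have q: "q = 2 * ((q - 1) div 2) + 1" using assms(2) by (auto elim: oddE)
    have "root2 ^ q = root2 ^ (2 * ((q - 1) div 2)) * root2"
      by (subst q) (simp del: mult_2)
    thus ?thesis by (simp only: root2_power_even power_mult_distrib of_int_power)
  qed
  also have "zcong (int q) (of_int ?a ^ q + \<dots>)
      (of_int ?a + of_int ?b * (of_int (2 ^ ((q - 1) div 2)) * root2))"
    unfolding of_int_power[symmetric, where z = ?a]
    by (intro zcong_add zcong_mult zcong_refl)
      (simp_all only: zcong_of_int_iff fermat_cong_int[OF assms(1)])
  also have "\<dots> = ZS ?a (2 ^ ((q - 1) div 2) * ?b)"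
    by (simp add: zsqrt2.expand del: of_int_power)
  finally show ?thesis .
qed

section \<open>Residue systems and linear congruences\<close>

definition zbox :: "nat \<Rightarrow> zsqrt2 set" where
  "zbox m = {z. zre z \<in> {0..<int m} \<and> zim z \<in> {0..<int m}}"

definition zred :: "nat \<Rightarrow> zsqrt2 \<Rightarrow> zsqrt2" where
  "zred m z = ZS (zre z mod int m) (zim z mod int m)"

lemma zbox_conv: "zbox m = (\<lambda>(a, b). ZS a b) ` ({0..<int m} \<times> {0..<int m})"
proof (intro equalityI subsetI)
  fix z assume "z \<in> zbox m"
  thus "z \<in> (\<lambda>(a, b). ZS a b) ` ({0..<int m} \<times> {0..<int m})"
    by (intro image_eqI[of _ _ "(zre z, zim z)"]) (auto simp: zbox_def)
qed (auto simp: zbox_def)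

lemma finite_zbox [simp]: "finite (zbox m)"
  by (simp add: zbox_conv)

lemma inj_ZS: "inj_on (\<lambda>(a, b). ZS a b) S"
  by (auto simp: inj_on_def)

lemma card_zbox: "card (zbox m) = m ^ 2"
  unfolding zbox_conv
  by (subst card_image[OF inj_ZS]) (simp add: card_cartesian_product power2_eq_square)

lemma zred_in_zbox [simp]: "m > 0 \<Longrightarrow> zred m z \<in> zbox m"
  by (simp add: zred_def zbox_def)

lemma zcong_zred [simp]: "zcong (int m) (zred m z) z"
  by (simp add: zred_def zcong_def)

lemma zcong_zbox_eq: "zcong (int m) z w \<Longrightarrow> z \<in> zbox m \<Longrightarrow> w \<in> zbox m \<Longrightarrow> z = w"
  by (simp add: zcong_def zbox_def cong_def zsqrt2.expand)

lemma zred_eq_iff: "zred m z = zred m w \<longleftrightarrow> zcong (int m) z w"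
  by (simp add: zred_def zcong_def cong_def)

lemma N_count_eq: "N_count p m = card {z \<in> zbox m. [coeff_sum (z ^ p) = 1] (mod int m)}"
proof -
  have "{z \<in> zbox m. [coeff_sum (z ^ p) = 1] (mod int m)} = (\<lambda>(a, b). ZS a b) `
     {(a, b). 0 \<le> a \<and> a < int m \<and> 0 \<le> b \<and> b < int m \<and> [form_F p a b = 1] (mod int m)}"
    by (auto simp: zbox_conv form_F_eq_coeff_sum)
  thus ?thesis unfolding N_count_def by (simp add: card_image[OF inj_ZS])
qed

text \<open>Since \<open>A\<close> is invertible modulo \<open>q\<close>, the coordinate
  \<open>v\<close> is free and determines \<open>u\<close>.\<close>

lemma card_linear_cong_aux:
  assumes q: "prime q" and A: "\<not> int q dvd A"
  shows "card {(u, v) \<in> {0..<int q} \<times> {0..<int q}. [A * u + B * v = e] (mod int q)} = q"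
proof -
  have q0: "q > 0" using q prime_gt_0_nat by blast
  have "coprime A (int q)"
    using q A by (metis coprime_commute prime_imp_coprime prime_int_nat_transfer nat_int of_nat_0_le_iff)
  then obtain i where i: "[A * i = 1] (mod int q)" using cong_solve_coprime_int by blast
  have "{(u, v) \<in> {0..<int q} \<times> {0..<int q}. [A * u + B * v = e] (mod int q)} =
      (\<lambda>v. ((e - B * v) * i mod int q, v)) ` {0..<int q}" (is "?L = ?R")
  proof (intro equalityI subsetI)
    fix x assume "x \<in> ?L"
    then obtain u v where x: "x = (u, v)" and uv: "u \<in> {0..<int q}" "v \<in> {0..<int q}" "[A * u + B * v = e] (mod int q)"
      by blast
    hence "[A * u = e - B * v] (mod int q)"
      by (metis add_diff_cancel_right' cong_diff cong_refl)
    hence "[A * u * i = (e - B * v) * i] (mod int q)" using cong_scalar_right by blast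
    moreover have "[A * u * i = u] (mod int q)"
      using cong_scalar_left[OF i, of u] by (simp add: mult_ac)
    ultimately have "[u = (e - B * v) * i] (mod int q)" using cong_sym cong_trans by blast
    hence "u = (e - B * v) * i mod int q" using uv(1) by (simp add: cong_def)
    thus "x \<in> ?R" using uv(2) x by auto
  next
    fix x assume "x \<in> ?R"
    then obtain v where v: "v \<in> {0..<int q}" and x: "x = ((e - B * v) * i mod int q, v)" by blast
    let ?u = "(e - B * v) * i mod int q"
    have "[A * ?u = (e - B * v) * (A * i)] (mod int q)"
      by (simp add: cong_def mod_mult_right_eq mult_ac)
    also have "[(e - B * v) * (A * i) = (e - B * v) * 1] (mod int q)"
      using i cong_scalar_left by blast
    finally have "[A * ?u + B * v = (e - B * v) * 1 + B * v] (mod int q)"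
      using cong_add cong_refl by blast
    thus "x \<in> ?L" using v q0 x by simp
  qed
  moreover have "inj_on (\<lambda>v. ((e - B * v) * i mod int q, v)) {0..<int q}"
    by (auto simp: inj_on_def)
  ultimately show ?thesis by (simp add: card_image)
qed

text \<open>One of the two coefficients is invertible; if it is \<open>B\<close>, the coordinates
  are swapped.\<close>

lemma card_linear_cong:
  assumes q: "prime q" and AB: "\<not> (int q dvd A \<and> int q dvd B)"
  shows "card {w \<in> zbox q. [A * zre w + B * zim w = e] (mod int q)} = q"
proof -
  let ?S = "\<lambda>A B. {(u, v) \<in> {0..<int q} \<times> {0..<int q}. [A * u + B * v = e] (mod int q)}"
  have "{w \<in> zbox q. [A * zre w + B * zim w = e] (mod int q)} = (\<lambda>(a, b). ZS a b) ` ?S A B"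
    by (auto simp: zbox_conv)
  hence "card {w \<in> zbox q. [A * zre w + B * zim w = e] (mod int q)} = card (?S A B)"
    by (simp add: card_image[OF inj_ZS])
  also have "\<dots> = q"
  proof (cases "int q dvd A")
    case False
    thus ?thesis by (rule card_linear_cong_aux[OF q])
  next
    case True
    have "?S A B = prod.swap ` ?S B A" by (auto simp: image_iff add.commute)
    hence "card (?S A B) = card (?S B A)" by (simp add: card_image)
    also have "\<dots> = q" using AB True by (intro card_linear_cong_aux[OF q]) blast
    finally show ?thesis .
  qed
  finally show ?thesis .
qed

section \<open>Lifting solutions from one prime power to the next\<close>

text \<open>Division with remainder by \<open>h\<close> in each coordinate: \<open>z\<close> is the
  low digit and \<open>w\<close> the high digit of a residue modulo \<open>h * q\<close>.\<close>

lemma bij_betw_zbox_digits: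
  assumes h: "h > 0"
  shows "bij_betw (\<lambda>(z, w). z + of_int (int h) * w) (zbox h \<times> zbox q) (zbox (h * q))"
proof -
  define f where "f = (\<lambda>(z :: zsqrt2, w). z + of_int (int h) * w)"
  have f_sel: "zre (f (z, w)) = zre z + int h * zre w" "zim (f (z, w)) = zim z + int h * zim w" for z w
    by (simp_all add: f_def del: of_int_of_nat_eq)
  have "f ` (zbox h \<times> zbox q) = zbox (h * q)"
  proof (intro equalityI subsetI)
    fix y assume "y \<in> f ` (zbox h \<times> zbox q)"
    then obtain z w where zw: "z \<in> zbox h" "w \<in> zbox q" "y = f (z, w)" by auto
    have bound: "0 \<le> a + int h * u \<and> a + int h * u < int h * int q"
      if "a \<in> {0..<int h}" "u \<in> {0..<int q}" for a u
    proof -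
      have "int h * u \<le> int h * (int q - 1)" using that by (intro mult_left_mono) auto
      thus ?thesis using that by (auto simp: algebra_simps)
    qed
    show "y \<in> zbox (h * q)"
      using zw bound[of "zre z" "zre w"] bound[of "zim z" "zim w"]
      by (auto simp: zbox_def f_sel)
  next
    fix y assume y: "y \<in> zbox (h * q)"
    define w where "w = ZS (zre y div int h) (zim y div int h)"
    have "y = f (zred h y, w)"
      by (simp add: w_def zred_def zsqrt2.expand f_sel)
    moreover have "x div int h < int q" if "x < int h * int q" for x
    proof (rule ccontr)
      assume "\<not> x div int h < int q"
      hence "int h * int q \<le> int h * (x div int h)" by (intro mult_left_mono) auto
      also have "\<dots> \<le> x" using h
        by (metis mult_div_mod_eq le_add_same_cancel1 pos_mod_sign of_nat_0_less_iff)
      finally show False using that by simp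
    qed
    hence "w \<in> zbox q"
      using y h by (auto simp: w_def zbox_def pos_imp_zdiv_nonneg_iff)
    ultimately show "y \<in> f ` (zbox h \<times> zbox q)" using h by force
  qed
  moreover have "inj_on f (zbox h \<times> zbox q)"
  proof (rule inj_onI, clarify)
    fix z w z' w'
    assume H: "z \<in> zbox h" "z' \<in> zbox h" "f (z, w) = f (z', w')"
    have eq: "zre z + int h * zre w = zre z' + int h * zre w'"
        "zim z + int h * zim w = zim z' + int h * zim w'"
      using arg_cong[OF H(3), of zre] arg_cong[OF H(3), of zim] by (simp_all add: f_sel)
    have "zcong (int h) z z'"
      unfolding zcong_def cong_def by (metis eq mod_mult_self2)
    hence "z = z'" using H(1,2) zcong_zbox_eq by blast
    moreover have "w = w'" using eq h \<open>z = z'\<close> by (simp add: zsqrt2.expand)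
    ultimately show "z = z' \<and> w = w'" by simp
  qed
  ultimately show ?thesis by (simp add: bij_betw_def f_def)
qed

text \<open>Fibres a count modulo \<open>h * q\<close> over the low digit, for conditions
  \<open>Q\<close> that split into one on \<open>z\<close> and one on \<open>w\<close> given
  \<open>z\<close>.\<close>

lemma card_zbox_digits:
  assumes h: "h > 0"
    and T: "\<And>z w. z \<in> zbox h \<Longrightarrow> w \<in> zbox q \<Longrightarrow>
      Q (z + of_int (int h) * w) \<longleftrightarrow> P z \<and> R z w"
  shows "card {y \<in> zbox (h * q). Q y} = (\<Sum>z | z \<in> zbox h \<and> P z. card {w \<in> zbox q. R z w})"
proof -
  let ?f = "\<lambda>(z, w). z + of_int (int h) * w"
  let ?S = "Sigma {z \<in> zbox h. P z} (\<lambda>z. {w \<in> zbox q. R z w})"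
  note bij = bij_betw_zbox_digits[OF h, of q]
  have im: "?f ` (zbox h \<times> zbox q) = zbox (h * q)" using bij by (simp add: bij_betw_def)
  have "{y \<in> zbox (h * q). Q y} = ?f ` ?S"
  proof (intro equalityI subsetI)
    fix y assume y: "y \<in> {y \<in> zbox (h * q). Q y}"
    hence "y \<in> ?f ` (zbox h \<times> zbox q)" unfolding im by simp
    then obtain z w where "z \<in> zbox h" "w \<in> zbox q" "y = z + of_int (int h) * w"
      by (elim imageE SigmaE) simp
    thus "y \<in> ?f ` ?S" using y T[of z w] by (intro image_eqI[of _ _ "(z, w)"]) auto
  next
    fix y assume "y \<in> ?f ` ?S"
    then obtain z w where zw: "z \<in> zbox h" "w \<in> zbox q" "P z" "R z w" "y = ?f (z, w)"
      by (elim imageE SigmaE) auto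
    hence "y \<in> zbox (h * q)" unfolding im[symmetric] by (intro image_eqI[of _ _ "(z, w)"]) auto
    thus "y \<in> {y \<in> zbox (h * q). Q y}" using zw T[of z w] by simp
  qed
  moreover have "inj_on ?f ?S"
    using bij unfolding bij_betw_def by (elim conjE inj_on_subset) blast
  ultimately have "card {y \<in> zbox (h * q). Q y} = card ?S" by (simp only: card_image)
  also have "\<dots> = (\<Sum>z | z \<in> zbox h \<and> P z. card {w \<in> zbox q. R z w})"
    by (intro card_SigmaI) auto
  finally show ?thesis .
qed

text \<open>A Hensel step in two variables, with \<open>(A z, B z)\<close> as the gradient of
  \<open>G\<close>. Raising the modulus along with the box puts one nondegenerate linear condition
  on the new digit \<open>w\<close>, which leaves \<open>q\<close> choices. Keeping the modulus puts
  no condition on \<open>w\<close>, which leaves \<open>q ^ 2\<close>.\<close>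

lemma card_lift:
  fixes G A B :: "zsqrt2 \<Rightarrow> int"
  assumes q: "prime q" and tc: "t + c > 0"
    and expand: "\<And>z w. [G (z + of_int (int (q ^ t)) * w) =
        G z + int q ^ (t + c) * (A z * zre w + B z * zim w)] (mod int q ^ Suc (t + c))"
    and nondeg: "\<And>z. [G z = 1] (mod int q) \<Longrightarrow> \<not> (int q dvd A z \<and> int q dvd B z)"
  shows "card {z \<in> zbox (q ^ Suc t). [G z = 1] (mod int q ^ Suc (t + c))} =
      q * card {z \<in> zbox (q ^ t). [G z = 1] (mod int q ^ (t + c))}"
    and "card {z \<in> zbox (q ^ Suc t). [G z = 1] (mod int q ^ (t + c))} =
      q ^ 2 * card {z \<in> zbox (q ^ t). [G z = 1] (mod int q ^ (t + c))}"
proof -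
  define Q where "Q = int q ^ (t + c)"
  have q0: "q > 0" using q prime_gt_0_nat by blast
  hence Q0: "Q \<noteq> 0" by (simp add: Q_def)
  have QS: "int q ^ Suc (t + c) = Q * int q" by (simp add: Q_def)
  have qt: "q ^ Suc t = q ^ t * q" by simp
  let ?S = "{z \<in> zbox (q ^ t). [G z = 1] (mod Q)}"
  \<comment> \<open>Modulo \<open>Q\<close> the value of \<open>G\<close> depends only on the low
    digit.\<close>
  have period: "[G (z + of_int (int (q ^ t)) * w) = G z] (mod Q)" for z w
  proof -
    have "[G (z + of_int (int (q ^ t)) * w) = G z + Q * (A z * zre w + B z * zim w)] (mod Q)"
      using expand[of z w] unfolding QS Q_def[symmetric] by (rule cong_modulus_mult)
    moreover have "[G z + Q * (A z * zre w + B z * zim w) = G z] (mod Q)"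
      by (simp add: cong_iff_dvd_diff)
    ultimately show ?thesis by (rule cong_trans)
  qed
  hence period_iff: "[G (z + of_int (int (q ^ t)) * w) = 1] (mod Q) \<longleftrightarrow> [G z = 1] (mod Q)" for z w
    by (meson cong_sym cong_trans)
  \<comment> \<open>With \<open>1 - G z = Q * k\<close>, dividing the lifted congruence by
    \<open>Q\<close> leaves a linear congruence modulo \<open>q\<close> with right-hand side
    \<open>k\<close>.\<close>
  have step: "[G (z + of_int (int (q ^ t)) * w) = 1] (mod Q * int q) \<longleftrightarrow> [G z = 1] (mod Q) \<and>
      [A z * zre w + B z * zim w = (1 - G z) div Q] (mod int q)" (is "?l \<longleftrightarrow> _ \<and> ?r") for z w
  proof (cases "[G z = 1] (mod Q)")
    case False
    thus ?thesis using period_iff cong_modulus_mult by blast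
  next
    case True
    hence "Q dvd 1 - G z" by (simp add: cong_iff_dvd_diff dvd_diff_commute)
    then obtain k where k: "1 - G z = Q * k" by blast
    have "?l \<longleftrightarrow> [G z + Q * (A z * zre w + B z * zim w) = 1] (mod Q * int q)"
      using expand[of z w] unfolding QS Q_def[symmetric] by (meson cong_sym cong_trans)
    also have "\<dots> \<longleftrightarrow> Q * int q dvd Q * (A z * zre w + B z * zim w - k)"
    proof -
      have "G z + Q * (A z * zre w + B z * zim w) - 1 = Q * (A z * zre w + B z * zim w) - (1 - G z)"
        by simp
      also have "\<dots> = Q * (A z * zre w + B z * zim w - k)"
        unfolding k by (simp only: right_diff_distrib)
      finally show ?thesis by (simp only: cong_iff_dvd_diff)
    qed
    also have "\<dots> \<longleftrightarrow> ?r" using Q0 k by (simp add: cong_iff_dvd_diff)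
    finally show ?thesis using True by simp
  qed
  have "card {z \<in> zbox (q ^ t * q). [G z = 1] (mod Q * int q)} =
      (\<Sum>z\<in>?S. card {w \<in> zbox q. [A z * zre w + B z * zim w = (1 - G z) div Q] (mod int q)})"
    by (intro card_zbox_digits step) (use q0 in simp)
  also have "\<dots> = (\<Sum>z\<in>?S. q)"
  proof (intro sum.cong refl)
    fix z assume "z \<in> ?S"
    hence "[G z = 1] (mod Q)" by simp
    moreover have "int q dvd Q" using tc by (simp add: Q_def)
    ultimately have "[G z = 1] (mod int q)" by (rule cong_dvd_modulus)
    thus "card {w \<in> zbox q. [A z * zre w + B z * zim w = (1 - G z) div Q] (mod int q)} = q"
      by (intro card_linear_cong[OF q] nondeg)
  qed
  finally show "card {z \<in> zbox (q ^ Suc t). [G z = 1] (mod int q ^ Suc (t + c))} =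
      q * card {z \<in> zbox (q ^ t). [G z = 1] (mod int q ^ (t + c))}"
    unfolding QS qt Q_def[symmetric] by simp
  have "card {z \<in> zbox (q ^ t * q). [G z = 1] (mod Q)} = (\<Sum>z\<in>?S. card {w \<in> zbox q. True})"
    by (intro card_zbox_digits) (use q0 period_iff in simp_all)
  thus "card {z \<in> zbox (q ^ Suc t). [G z = 1] (mod int q ^ (t + c))} =
      q ^ 2 * card {z \<in> zbox (q ^ t). [G z = 1] (mod int q ^ (t + c))}"
    unfolding qt Q_def[symmetric] by (simp add: card_zbox)
qed

section \<open>First-order expansion of the form\<close>

lemma coeff_sum_mult:
  "coeff_sum (v * w) = coeff_sum v * zre w + coeff_sum (v * root2) * zim w"
  by (simp add: coeff_sum_def algebra_simps)

text \<open>The binomial terms \<open>k = 0\<close> and \<open>k = 1\<close> give the value and the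
  derivative, and \<open>dv\<close> removes all others. The exponent \<open>t + c\<close> arises
  because the linear term carries \<open>p * q ^ t = P * q ^ (t + c)\<close>.\<close>

lemma coeff_sum_power_expand:
  fixes p q t c P :: nat
  assumes p: "p = P * q ^ c" "p > 1"
    and dv: "\<And>k. k \<in> {2..p} \<Longrightarrow> q ^ Suc (t + c) dvd (p choose k) * (q ^ t) ^ k"
  shows "[coeff_sum ((z + of_int (int (q ^ t)) * w) ^ p) = coeff_sum (z ^ p) +
      int q ^ (t + c) * (int P * coeff_sum (z ^ (p - 1)) * zre w +
        int P * coeff_sum (z ^ (p - 1) * root2) * zim w)] (mod int q ^ Suc (t + c))"
proof -
  let ?h = "int (q ^ t)"
  let ?f = "\<lambda>k. int (p choose k) * ?h ^ k * coeff_sum (z ^ (p - k) * w ^ k)"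
  have "(z + of_int ?h * w) ^ p = (of_int ?h * w + z) ^ p" by (simp only: add.commute)
  also have "\<dots> = (\<Sum>k\<le>p. of_nat (p choose k) * (of_int ?h * w) ^ k * z ^ (p - k))"
    by (rule binomial_ring)
  also have "\<dots> = (\<Sum>k\<le>p. of_int (int (p choose k) * ?h ^ k) * (z ^ (p - k) * w ^ k))"
    by (intro sum.cong) (auto simp: power_mult_distrib algebra_simps)
  finally have "coeff_sum ((z + of_int ?h * w) ^ p) = (\<Sum>k\<le>p. ?f k)"
    by (simp only: coeff_sum_sum coeff_sum_scale)
  also have "{..p} = insert 0 (insert 1 {2..p})" using p(2) by auto
  also have "(\<Sum>k\<in>\<dots>. ?f k) = coeff_sum (z ^ p) + int p * ?h * coeff_sum (z ^ (p - 1) * w) +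
      (\<Sum>k\<in>{2..p}. ?f k)"
    by simp
  also have "int p * ?h * coeff_sum (z ^ (p - 1) * w) =
      int q ^ (t + c) * (int P * coeff_sum (z ^ (p - 1)) * zre w +
        int P * coeff_sum (z ^ (p - 1) * root2) * zim w)"
    by (subst coeff_sum_mult) (simp add: p(1) power_add algebra_simps)
  finally have eq: "coeff_sum ((z + of_int ?h * w) ^ p) = coeff_sum (z ^ p) +
      int q ^ (t + c) * (int P * coeff_sum (z ^ (p - 1)) * zre w +
        int P * coeff_sum (z ^ (p - 1) * root2) * zim w) + (\<Sum>k\<in>{2..p}. ?f k)" .
  have "int q ^ Suc (t + c) dvd ?f k" if "k \<in> {2..p}" for k
  proof -
    have "int (q ^ Suc (t + c)) dvd int ((p choose k) * (q ^ t) ^ k)"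
      using dv[OF that] by (simp only: of_nat_dvd_iff)
    thus ?thesis by (simp add: dvd_mult2)
  qed
  hence "int q ^ Suc (t + c) dvd (\<Sum>k\<in>{2..p}. ?f k)" by (rule dvd_sum)
  thus ?thesis unfolding eq cong_iff_dvd_diff by (simp only: add_diff_cancel_left')
qed

text \<open>
  For q = p the form modulo p ^ (t + 1) depends only on z modulo p ^ t; taking c = 1 there
  imposes the congruence one exponent higher than the box, and c = 0 covers q \<noteq> p.
\<close>
definition sol_count :: "nat \<Rightarrow> nat \<Rightarrow> nat \<Rightarrow> nat \<Rightarrow> nat" where
  "sol_count p q c t = card {z \<in> zbox (q ^ t). [coeff_sum (z ^ p) = 1] (mod int q ^ (t + c))}"

lemma sol_count_lift:
  fixes p q t c P :: nat
  assumes q: "prime q" and t: "t > 0" and p: "p = P * q ^ c" "p > 1" and P: "coprime P q"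
    and dv: "\<And>k. k \<in> {2..p} \<Longrightarrow> q ^ Suc (t + c) dvd (p choose k) * (q ^ t) ^ k"
  shows "sol_count p q c (Suc t) = q * sol_count p q c t"
    and "card {z \<in> zbox (q ^ Suc t). [coeff_sum (z ^ p) = 1] (mod int q ^ (t + c))} =
      q ^ 2 * sol_count p q c t"
proof -
  let ?A = "\<lambda>z. int P * coeff_sum (z ^ (p - 1))"
  let ?B = "\<lambda>z. int P * coeff_sum (z ^ (p - 1) * root2)"
  \<comment> \<open>Euler's identity for homogeneous forms: pairing the gradient with
    \<open>z\<close> itself gives \<open>int P * coeff_sum (z ^ p)\<close>, which is a unit modulo
    \<open>q\<close> at a solution.\<close>
  have nondeg: "\<not> (int q dvd ?A z \<and> int q dvd ?B z)" if z: "[coeff_sum (z ^ p) = 1] (mod int q)" for z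
  proof
    assume H: "int q dvd ?A z \<and> int q dvd ?B z"
    hence "int q dvd ?A z * zre z + ?B z * zim z" by (simp add: dvd_add dvd_mult2)
    also have "?A z * zre z + ?B z * zim z = int P * coeff_sum (z ^ (p - 1) * z)"
      by (subst coeff_sum_mult) (simp add: algebra_simps)
    also have "z ^ (p - 1) * z = z ^ p" using p(2) by (intro power_minus_mult) simp
    finally have "int q dvd int P * coeff_sum (z ^ p)" .
    moreover have "coprime (int q) (int P)" using P by (simp add: coprime_commute)
    ultimately have "int q dvd coeff_sum (z ^ p)" by (simp add: coprime_dvd_mult_right_iff)
    hence "int q dvd 1" using z cong_dvd_iff cong_sym
      by (metis cong_0_iff cong_trans)
    thus False using q by (simp add: prime_gt_Suc_0_nat not_prime_1 nat_dvd_1_iff_1 zdvd1_eq)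
  qed
  have tc: "t + c > 0" using t by simp
  note * = card_lift[where G = "\<lambda>z. coeff_sum (z ^ p)" and A = ?A and B = ?B, OF q tc
      coeff_sum_power_expand[OF p dv] nondeg]
  show "sol_count p q c (Suc t) = q * sol_count p q c t"
    using *(1) by (simp add: sol_count_def)
  show "card {z \<in> zbox (q ^ Suc t). [coeff_sum (z ^ p) = 1] (mod int q ^ (t + c))} =
      q ^ 2 * sol_count p q c t"
    using *(2) by (simp add: sol_count_def)
qed

text \<open>The lifting step with \<open>c = 0\<close> and \<open>P = p\<close>. The terms with
  \<open>k\<close> at least 2 vanish because \<open>s * k\<close> is at least \<open>2 * s\<close>,
  hence at least \<open>s + 1\<close>.\<close>

lemma N_count_prime_power:
  assumes q: "prime q" and p: "prime p" and pq: "q \<noteq> p" and s: "s \<ge> 1"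
  shows "N_count p (q ^ s) = q ^ (s - 1) * N_count p q"
  using s
proof (induction s rule: dec_induct)
  case base
  show ?case by simp
next
  case (step s)
  have "sol_count p q 0 (Suc s) = q * sol_count p q 0 s"
  proof (rule sol_count_lift(1)[OF q, of _ _ p])
    show "s > 0" "p = p * q ^ 0" "p > 1" using step p prime_gt_1_nat by auto
    show "coprime p q" using p q pq by (simp add: primes_coprime)
    fix k assume "k \<in> {2..p}"
    hence "s * 2 \<le> s * k" by simp
    hence "Suc (s + 0) \<le> s * k" using step(1) by linarith
    thus "q ^ Suc (s + 0) dvd (p choose k) * (q ^ s) ^ k"
      by (simp add: dvd_mult le_imp_power_dvd flip: power_mult power_Suc)
  qed
  hence "N_count p (q ^ Suc s) = q * N_count p (q ^ s)"
    by (simp add: sol_count_def N_count_eq)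
  also have "\<dots> = q * q ^ (s - 1) * N_count p q" using step by simp
  also have "q * q ^ (s - 1) = q ^ s" using step by (cases s) auto
  finally show ?case by simp
qed

text \<open>The lifting step with \<open>c = 1\<close> and \<open>P = 1\<close> climbs from the box
  of \<open>p\<close> to that of \<open>p ^ (s - 1)\<close>, reaching the modulus
  \<open>p ^ s\<close>. Enlarging the box to \<open>p ^ s\<close> at this modulus contributes the
  last factor \<open>p ^ 2\<close>.\<close>

lemma N_count_prime_power_self:
  assumes p: "prime p" "odd p" and s: "s > 1"
  shows "N_count p (p ^ s) = p * p ^ (s - 1) * sol_count p p 1 1"
proof -
  have p1: "p > 1" using p prime_gt_1_nat by blast
  have p3: "p \<ge> 3" using p p1 by (cases "p = 2") auto
  \<comment> \<open>For \<open>k < p\<close> the binomial coefficient supplies one factor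
    \<open>p\<close>. For \<open>k = p\<close> it is 1, and \<open>t * p\<close> reaches
    \<open>t + 2\<close> because \<open>p\<close> is at least 3.\<close>
  have dv: "p ^ Suc (t + 1) dvd (p choose k) * (p ^ t) ^ k" if t: "t > 0" and k: "k \<in> {2..p}" for t k
  proof (cases "k = p")
    case True
    have "t * 3 \<le> t * p" using p3 by simp
    hence "t + 2 \<le> t * p" using t by linarith
    thus ?thesis using True by (simp add: le_imp_power_dvd flip: power_mult power_Suc)
  next
    case False
    hence "p dvd (p choose k)" using k p by (intro dvd_choose_prime) auto
    moreover have "t * 2 \<le> t * k" using k by simp
    hence "p ^ (t + 1) dvd (p ^ t) ^ k"
      unfolding power_mult[symmetric] using t by (intro le_imp_power_dvd) linarith
    ultimately have "p * p ^ (t + 1) dvd (p choose k) * (p ^ t) ^ k" by (rule mult_dvd_mono)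
    thus ?thesis by simp
  qed
  have cnt: "sol_count p p 1 (Suc t) = p ^ t * sol_count p p 1 1" for t
  proof (induction t)
    case (Suc t)
    have "sol_count p p 1 (Suc (Suc t)) = p * sol_count p p 1 (Suc t)"
      by (rule sol_count_lift(1)[where P = 1, OF p(1) _ _ p1 _ dv]) auto
    thus ?case using Suc by simp
  qed simp
  obtain t where t: "s = Suc (Suc t)" using s by (auto simp: less_iff_Suc_add)
  have "card {z \<in> zbox (p ^ Suc (Suc t)). [coeff_sum (z ^ p) = 1] (mod int p ^ (Suc t + 1))} =
      p ^ 2 * sol_count p p 1 (Suc t)"
    by (rule sol_count_lift(2)[where P = 1, OF p(1) _ _ p1 _ dv]) auto
  thus ?thesis using cnt[of t] t by (simp add: N_count_eq power2_eq_square)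
qed

section \<open>Counting modulo a prime\<close>

text \<open>The period is stated as \<open>x ^ Suc n\<close> being \<open>x\<close>, rather than
  \<open>x ^ n\<close> being 1, so that zero and other non-units are covered.\<close>

lemma dvd_power_period:
  fixes x :: "'a::comm_ring_1"
  assumes "m dvd x ^ Suc n - x"
  shows "m dvd x ^ (1 + k * n) - x"
proof (induction k)
  case (Suc k)
  have "x ^ (1 + Suc k * n) - x = x ^ n * (x ^ (1 + k * n) - x) + (x ^ Suc n - x)"
    by (simp add: algebra_simps power_add)
  thus ?case using Suc assms by (simp only: dvd_add dvd_mult)
qed simp

lemma coprime_inverse_exponent:
  assumes "coprime p n" "n > (0::nat)" "p > 0"
  obtains m k where "p * m = 1 + k * n"
proof -
  obtain x where x: "[p * x = Suc 0] (mod n)" using cong_solve_coprime_nat assms(1) by blast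
  \<comment> \<open>Adding \<open>n\<close> makes the inverse positive, also when
    \<open>n = 1\<close> and \<open>x = 0\<close>; then \<open>p * ?x\<close> is at least 1 and
    \<open>k\<close> is a natural number.\<close>
  let ?x = "x + n"
  have "[p * ?x = 1] (mod n)" using x by (simp add: cong_def algebra_simps)
  moreover have "p * ?x \<ge> 1" using assms by (simp add: Suc_le_eq)
  ultimately obtain k where "p * ?x = 1 + k * n"
    by (metis cong_le_nat add.commute mult.commute)
  thus ?thesis using that by blast
qed

text \<open>With \<open>p * m = 1 + k * n\<close>, raising to the power \<open>m\<close> undoes
  raising to the power \<open>p\<close>. So \<open>p\<close>-th powers permute the residues, and the
  solutions correspond to the points of a line.\<close>

lemma N_count_power_bijective:
  assumes q: "prime q" and per: "\<And>z. zcong (int q) (z ^ Suc n) z"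
    and cop: "coprime p n" and n: "n > 0" "p > 0"
  shows "N_count p q = q"
proof -
  have q0: "q > 0" using q prime_gt_0_nat by blast
  obtain m k where mk: "p * m = 1 + k * n" using coprime_inverse_exponent[OF cop n] .
  have root: "zcong (int q) ((z ^ p) ^ m) z" for z
    unfolding power_mult[symmetric] mk zcong_iff_dvd
    by (rule dvd_power_period) (use per zcong_iff_dvd in blast)
  define f where "f z = zred q (z ^ p)" for z
  have inj: "inj_on f (zbox q)"
  proof (rule inj_onI)
    fix z w assume zw: "z \<in> zbox q" "w \<in> zbox q" "f z = f w"
    hence "zcong (int q) ((z ^ p) ^ m) ((w ^ p) ^ m)"
      by (intro zcong_power[of _ "_ ^ p"]) (simp add: f_def zred_eq_iff)
    hence "zcong (int q) z w" using root by (meson zcong_sym zcong_trans)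
    thus "z = w" using zw zcong_zbox_eq by blast
  qed
  have im: "f ` zbox q = zbox q"
    by (rule endo_inj_surj[OF finite_zbox _ inj]) (use q0 in \<open>auto simp: f_def\<close>)
  have f_iff: "[coeff_sum (z ^ p) = 1] (mod int q) \<longleftrightarrow> [coeff_sum (f z) = 1] (mod int q)" for z
    using zcong_coeff_sum[OF zcong_zred[of q "z ^ p"]] unfolding f_def
    by (meson cong_sym cong_trans)
  have "f ` {z \<in> zbox q. [coeff_sum (z ^ p) = 1] (mod int q)} =
      {w \<in> zbox q. [coeff_sum w = 1] (mod int q)}"
    using im by (auto simp: f_iff)
  moreover have "inj_on f {z \<in> zbox q. [coeff_sum (z ^ p) = 1] (mod int q)}"
    using inj by (rule inj_on_subset) auto
  ultimately have "N_count p q = card {w \<in> zbox q. [1 * zre w + 1 * zim w = 1] (mod int q)}"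
    unfolding N_count_eq by (simp add: coeff_sum_def flip: card_image)
  also have "\<dots> = q"
    using q by (intro card_linear_cong) (auto simp: zdvd1_eq not_prime_1)
  finally show ?thesis .
qed

lemma zcong_frobenius_split:
  assumes "prime q" "odd q" "Legendre 2 (int q) = 1"
  shows "zcong (int q) (z ^ q) z"
proof -
  have "q > 2" using assms prime_ge_2_nat[of q] by (cases "q = 2") auto
  hence "[1 = 2 ^ ((q - 1) div 2)] (mod int q)"
    using euler_criterion[of q 2] assms by simp
  hence "zcong (int q) (ZS (zre z) (2 ^ ((q - 1) div 2) * zim z)) z"
    unfolding zcong_def using cong_scalar_right[of 1 _ "int q" "zim z"] cong_sym by auto
  thus ?thesis using zcong_frobenius[OF assms(1,2)] zcong_trans by blast
qed

text \<open>Applying Frobenius twice multiplies the second coordinate by \<open>e * e\<close>, and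
  \<open>e * e * 2 = 2 ^ q\<close> is 2 modulo \<open>q\<close>. The split and inert cases are thus
  treated together.\<close>

lemma zcong_frobenius_square:
  assumes q: "prime q" "odd q"
  shows "zcong (int q) (z ^ (q ^ 2)) z"
proof -
  define e where "e = (2::int) ^ ((q - 1) div 2)"
  have "e * e * 2 = 2 ^ q"
  proof -
    have "q = (q - 1) div 2 + (q - 1) div 2 + 1" using q(2) by (auto elim: oddE)
    thus ?thesis unfolding e_def by (metis power_add power_one_right)
  qed
  hence "[e * e * 2 = 1 * 2] (mod int q)" using fermat_cong_int[OF q(1), of 2] by simp
  moreover have "coprime 2 (int q)" using q(2) by simp
  ultimately have ee: "[e * e = 1] (mod int q)" using cong_mult_rcancel by blast
  have "z ^ (q ^ 2) = (z ^ q) ^ q" by (simp add: power2_eq_square power_mult)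
  also have "zcong (int q) \<dots> (ZS (zre z) (e * zim z) ^ q)"
    unfolding e_def by (intro zcong_power zcong_frobenius q)
  also have "zcong (int q) \<dots> (ZS (zre z) (e * (e * zim z)))"
    using zcong_frobenius[OF q, of "ZS (zre z) (e * zim z)"] by (simp add: e_def)
  also have "zcong (int q) \<dots> z"
    using cong_scalar_right[OF ee, of "zim z"] by (simp add: zcong_def mult.assoc)
  finally show ?thesis .
qed

text \<open>When the exponent equals the characteristic, Frobenius turns the form into a linear
  one.\<close>

lemma N_count_self:
  assumes p: "prime p" "odd p"
  shows "N_count p p = p"
proof -
  let ?e = "2 ^ ((p - 1) div 2) :: int"
  have "[coeff_sum (z ^ p) = 1] (mod int p) \<longleftrightarrow> [1 * zre z + ?e * zim z = 1] (mod int p)" for z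
    using zcong_coeff_sum[OF zcong_frobenius[OF p, of z]]
    by (simp add: coeff_sum_def) (meson cong_sym cong_trans)
  hence "N_count p p = card {z \<in> zbox p. [1 * zre z + ?e * zim z = 1] (mod int p)}"
    by (simp add: N_count_eq)
  also have "\<dots> = p"
    using p by (intro card_linear_cong) (auto simp: zdvd1_eq not_prime_1)
  finally show ?thesis .
qed

text \<open>Of the four residues only 1 is a solution. The square of 1 + sqrt 2 is 1 modulo 2, so
  its odd powers have even coefficient sum; for sqrt 2 the sum is a positive power of 2.\<close>

lemma N_count_two:
  assumes p: "odd p" "p > 1"
  shows "N_count p 2 = 1"
proof -
  obtain j where j: "p = 2 * j + 1" using p oddE by blast
  hence j0: "j > 0" using p by simp
  have "zcong 2 (ZS 1 1 ^ 2) 1"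
    by (simp add: power2_eq_square zcong_def cong_def)
  hence "zcong 2 ((ZS 1 1 ^ 2) ^ j * ZS 1 1) (1 ^ j * ZS 1 1)"
    by (intro zcong_mult zcong_power zcong_refl)
  hence "zcong 2 (ZS 1 1 ^ p) (ZS 1 1)"
    by (simp add: j flip: power_mult) (simp add: mult.commute)
  hence "[coeff_sum (ZS 1 1 ^ p) = coeff_sum (ZS 1 1)] (mod 2)" by (rule zcong_coeff_sum)
  hence 1: "\<not> [coeff_sum (ZS 1 1 ^ p) = 1] (mod 2)" by (simp add: coeff_sum_def cong_def)
  have "even (coeff_sum (root2 ^ p))" unfolding coeff_sum_root2_power using j j0 by simp
  hence 2: "\<not> [coeff_sum (root2 ^ p) = 1] (mod 2)" by (simp add: cong_def)
  have 3: "\<not> [coeff_sum (ZS 0 0 ^ p) = 1] (mod 2)"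
    using p by (simp add: coeff_sum_def cong_def power_0_left flip: zero_zsqrt2_def)
  have 4: "[coeff_sum (ZS 1 0 ^ p) = 1] (mod 2)"
    by (simp add: coeff_sum_def flip: one_zsqrt2_def)
  have "{0..<2} = {0, 1::int}" by auto
  hence "zbox 2 = {ZS 0 0, ZS 1 0, ZS 0 1, ZS 1 1}" by (auto simp: zbox_conv)
  hence "{z \<in> zbox 2. [coeff_sum (z ^ p) = 1] (mod int 2)} = {ZS 1 0}"
    using 1 2 3 4 by auto
  thus ?thesis by (simp add: N_count_eq)
qed

text \<open>The period is \<open>q ^ 2 - 1 = (q - 1) * (q + 1)\<close>, which is prime to
  \<open>p\<close>.\<close>

lemma N_count_generic:
  assumes p: "prime p" and q: "prime q" "odd q" and "\<not> p dvd q - 1" "\<not> p dvd q + 1"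
  shows "N_count p q = q"
proof (rule N_count_power_bijective[OF q(1), of "q ^ 2 - 1"])
  have q1: "q > 1" using q prime_gt_1_nat by blast
  have q2: "q ^ 2 > 1" using q1 one_less_power[of q 2] by simp
  have sq: "q ^ 2 - 1 = (q - 1) * (q + 1)" using q1 by (cases q) (auto simp: power2_eq_square)
  have "Suc (q ^ 2 - 1) = q ^ 2" using q2 by linarith
  thus "zcong (int q) (z ^ Suc (q ^ 2 - 1)) z" for z
    using zcong_frobenius_square[OF q, of z] by (simp only:)
  show "coprime p (q ^ 2 - 1)"
    unfolding sq coprime_mult_right_iff using assms by (blast intro: prime_imp_coprime)
  show "q ^ 2 - 1 > 0" using q2 by simp
  show "p > 0" using p prime_gt_0_nat by blast
qed

text \<open>Here Frobenius is the identity, so the shorter period \<open>q - 1\<close> is available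
  and \<open>p\<close> may divide \<open>q + 1\<close>.\<close>

lemma N_count_split:
  assumes p: "prime p" and q: "prime q" "odd q" and "\<not> p dvd q - 1" and leg: "Legendre 2 (int q) = 1"
  shows "N_count p q = q"
proof (rule N_count_power_bijective[OF q(1), of "q - 1"])
  have q1: "q > 1" using q prime_gt_1_nat by blast
  have "Suc (q - 1) = q" using q1 by linarith
  thus "zcong (int q) (z ^ Suc (q - 1)) z" for z
    using zcong_frobenius_split[OF q leg, of z] by (simp only:)
  show "coprime p (q - 1)" using assms by (simp add: prime_imp_coprime)
  show "q - 1 > 0" using q1 by simp
  show "p > 0" using p prime_gt_0_nat by blast
qed

section \<open>Scaling by p-th roots of unity in F_q\<close>

lemma power_scale: "(of_int l * z) ^ n = of_int (l ^ n) * (z :: zsqrt2) ^ n"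
  by (simp add: power_mult_distrib)

lemma N_count_pos:
  assumes "m > 1"
  shows "N_count p m > 0"
proof -
  have "1 \<in> {z \<in> zbox m. [coeff_sum (z ^ p) = 1] (mod int m)}"
    using assms by (simp add: zbox_def coeff_sum_def)
  thus ?thesis unfolding N_count_eq by (subst card_gt_0_iff) auto
qed

text \<open>An element \<open>l\<close> of order \<open>p\<close> modulo \<open>q\<close> acts on
  the solutions by multiplication. The action is free, so each of its orbits, the classes of
  \<open>r\<close>, has \<open>p\<close> elements.\<close>

lemma prime_dvd_N_count:
  assumes p: "prime p" and q: "prime q" and pq: "p dvd q - 1"
  shows "p dvd N_count p q"
proof -
  have q1: "q > 1" and p1: "p > 1" using p q prime_gt_1_nat by auto
  obtain g where g: "residue_primroot q g" using prime_primitive_root_exists[OF q1 q] by blast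
  define l where "l = g ^ ((q - 1) div p)"
  have cop: "coprime q g" and ordg: "ord q g = q - 1"
    using g q by (auto simp: residue_primroot_def totient_prime)
  obtain d where d: "q - 1 = p * d" using pq by blast
  have "d > 0" using d q1 by (cases d) auto
  hence ordl: "ord q l = p"
    using d p1 q1 ord_power[OF cop, of "(q - 1) div p"] by (simp add: l_def ordg)
  have copl: "coprime q l" using cop by (simp add: l_def)
  let ?s = "\<lambda>i z. of_int (int l ^ i) * z"
  define S where "S = {z \<in> zbox q. [coeff_sum (z ^ p) = 1] (mod int q)}"
  define r where "r = {(z, w). z \<in> S \<and> w \<in> S \<and> (\<exists>i. zcong (int q) w (?s i z))}"
  have lp: "[int l ^ p = 1] (mod int q)"
    using ord[of l q] ordl by (metis cong_int_iff of_nat_1 of_nat_power)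
  \<comment> \<open>Scaling by \<open>l ^ i\<close> multiplies the value by a power of
    \<open>l ^ p\<close>, which is 1 modulo \<open>q\<close>.\<close>
  have S_scale: "zred q (?s i z) \<in> S" if "z \<in> S" for i z
  proof -
    have "[coeff_sum (zred q (?s i z) ^ p) = coeff_sum (?s i z ^ p)] (mod int q)"
      by (intro zcong_coeff_sum zcong_power zcong_zred)
    also have "coeff_sum (?s i z ^ p) = (int l ^ p) ^ i * coeff_sum (z ^ p)"
      by (simp only: power_scale coeff_sum_scale mult.commute[of i p] flip: power_mult)
    also have "[\<dots> = 1 ^ i * 1] (mod int q)"
      using that lp by (intro cong_mult cong_pow) (auto simp: S_def)
    finally show ?thesis using q1 by (simp add: S_def)
  qed
  have "equiv S r"
  proof (rule equivI)
    show "r \<subseteq> S \<times> S" by (auto simp: r_def)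
    show "refl_on S r"
      by (auto simp: refl_on_def r_def intro!: exI[of _ 0])
    show "sym r"
    proof (rule symI)
      fix z w assume "(z, w) \<in> r"
      then obtain i where i: "z \<in> S" "w \<in> S" "zcong (int q) w (?s i z)" by (auto simp: r_def)
      \<comment> \<open>The exponent \<open>(p - 1) * i\<close> inverts scaling by
        \<open>l ^ i\<close>, since the two add up to a multiple of \<open>p\<close>.\<close>
      have "zcong (int q) (?s ((p - 1) * i) w) (?s ((p - 1) * i) (?s i z))"
        by (intro zcong_mult zcong_refl i)
      also have "?s ((p - 1) * i) (?s i z) = of_int ((int l ^ p) ^ i) * z"
      proof -
        have "(p - 1) * i + i = p * i" using p1 by (cases p) auto
        hence "int l ^ ((p - 1) * i) * int l ^ i = (int l ^ p) ^ i"
          by (simp flip: power_add power_mult)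
        thus ?thesis by (metis mult.assoc of_int_mult)
      qed
      also have "zcong (int q) \<dots> (of_int (1 ^ i) * z)"
        by (intro zcong_mult zcong_refl) (simp only: zcong_of_int_iff, intro cong_pow lp)
      finally have "zcong (int q) z (?s ((p - 1) * i) w)" using zcong_sym by simp
      thus "(w, z) \<in> r" using i by (auto simp: r_def)
    qed
    show "trans r"
    proof (rule transI)
      fix z w v assume "(z, w) \<in> r" "(w, v) \<in> r"
      then obtain i j where ij: "z \<in> S" "v \<in> S" "zcong (int q) w (?s i z)" "zcong (int q) v (?s j w)"
        by (auto simp: r_def)
      have "zcong (int q) v (?s j (?s i z))"
        using ij(3,4) by (meson zcong_mult zcong_refl zcong_trans)
      also have "?s j (?s i z) = ?s (j + i) z" by (simp add: power_add mult.assoc)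
      finally show "(z, v) \<in> r" using ij by (auto simp: r_def)
    qed
  qed
  moreover have "p dvd card X" if X: "X \<in> S // r" for X
  proof -
    obtain z where z: "z \<in> S" "X = r `` {z}" using X by (auto elim: quotientE)
    have "X = (\<lambda>i. zred q (?s i z)) ` {..<p}"
    proof (intro equalityI subsetI)
      fix w assume "w \<in> X"
      then obtain i where i: "w \<in> S" "zcong (int q) w (?s i z)" using z by (auto simp: r_def)
      have "[l ^ i = l ^ (i mod p)] (mod q)"
        using order_divides_expdiff[OF copl] ordl by (simp add: cong_def)
      hence "[int l ^ i = int l ^ (i mod p)] (mod int q)" by (metis cong_int_iff of_nat_power)
      hence "zcong (int q) (?s i z) (?s (i mod p) z)"
        by (intro zcong_mult zcong_refl) (simp only: zcong_of_int_iff)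
      hence "zcong (int q) w (zred q (?s (i mod p) z))"
        using i by (meson zcong_sym zcong_trans zcong_zred)
      hence "w = zred q (?s (i mod p) z)"
        using i S_scale[OF z(1)] zcong_zbox_eq[of q] by (auto simp: S_def)
      thus "w \<in> (\<lambda>i. zred q (?s i z)) ` {..<p}" using p1 by auto
    next
      fix w assume "w \<in> (\<lambda>i. zred q (?s i z)) ` {..<p}"
      thus "w \<in> X" using z S_scale by (auto simp: r_def simp del: of_int_power intro: zcong_zred)
    qed
    moreover have "inj_on (\<lambda>i. zred q (?s i z)) {..<p}"
    proof (rule inj_onI)
      fix i j assume ij: "i \<in> {..<p}" "j \<in> {..<p}" "zred q (?s i z) = zred q (?s j z)"
      hence *: "[int l ^ i * zre z = int l ^ j * zre z] (mod int q)"
        "[int l ^ i * zim z = int l ^ j * zim z] (mod int q)"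
        by (simp_all add: zred_eq_iff zcong_def del: of_int_power)
      \<comment> \<open>A solution is nonzero modulo \<open>q\<close>, so one of its coordinates can
        be cancelled; this gives freeness.\<close>
      have "\<not> (int q dvd zre z \<and> int q dvd zim z)"
      proof
        assume "int q dvd zre z \<and> int q dvd zim z"
        hence "zcong (int q) (z ^ p) (0 ^ p)"
          by (intro zcong_power) (simp add: zcong_def cong_0_iff)
        hence "[coeff_sum (z ^ p) = coeff_sum (0 ^ p)] (mod int q)" by (rule zcong_coeff_sum)
        hence "[1 = 0] (mod int q)"
          using z(1) p1 by (simp add: S_def coeff_sum_def power_0_left) (meson cong_sym cong_trans)
        thus False using q1 by (simp add: cong_def)
      qed
      hence "coprime (zre z) (int q) \<or> coprime (zim z) (int q)"
        using q by (metis coprime_commute prime_imp_coprime prime_nat_int_transfer)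
      hence "[int l ^ i = int l ^ j] (mod int q)" using * cong_mult_rcancel by blast
      hence "[l ^ i = l ^ j] (mod q)" by (metis cong_int_iff of_nat_power)
      hence "[i = j] (mod p)" using order_divides_expdiff[OF copl] ordl by simp
      thus "i = j" using ij by (simp add: cong_def)
    qed
    ultimately show ?thesis by (simp add: card_image)
  qed
  moreover have "finite S" by (simp add: S_def)
  ultimately have "p dvd card S" using equiv_imp_dvd_card by blast
  thus ?thesis by (simp add: N_count_eq S_def)
qed

section \<open>Roots of unity in the inert residue field\<close>

text \<open>The multiplicative group is cyclic of order divisible by \<open>p\<close>, so it
  contains an element of order \<open>p\<close>. The number of such elements is then the totient
  \<open>p - 1\<close>, and the remaining root is \<open>\<one>\<close>.\<close>

lemma (in field) card_roots_of_unity_prime: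
  assumes fin: "finite (carrier R)" and p: "prime p" and dvd: "p dvd card (carrier R) - 1"
  shows "card {x \<in> carrier R. x [^] p = \<one>} = p"
proof -
  have fin': "finite (carrier (mult_of R))" using fin by (rule finite_mult_of)
  interpret G: group "mult_of R" rewrites
      "([^]\<^bsub>mult_of R\<^esub>) = (([^]) :: _ \<Rightarrow> nat \<Rightarrow> _)" and "\<one>\<^bsub>mult_of R\<^esub> = \<one>"
    by (rule field_mult_group) (simp_all add: fun_eq_iff nat_pow_def mult_of_simps)
  have p1: "p > 1" using p prime_gt_1_nat by blast
  let ?n = "order (mult_of R)"
  have pn: "p dvd ?n" using dvd fin by (simp add: order_mult_of order_def)
  have n0: "?n > 0" using fin' G.order_gt_0_iff_finite by blast
  obtain g where g: "g \<in> carrier (mult_of R)" "carrier (mult_of R) = {g [^] i | i::nat. i \<in> UNIV}"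
    using finite_field_mult_group_has_gen[OF fin] by blast
  \<comment> \<open>The powers of \<open>g\<close> exhaust the group and are already listed below
    \<open>G.ord g\<close>, so the order of \<open>g\<close> is the order of the group.\<close>
  have "{g [^] i | i::nat. i \<in> UNIV} = (\<lambda>x. g [^] x) ` {0 .. G.ord g - 1}"
    using G.ord_elems[OF fin' g(1)] by blast
  hence "?n \<le> card {0 .. G.ord g - 1}"
    unfolding order_def g(2) by (metis card_image_le finite_atLeastAtMost)
  moreover have "G.ord g \<ge> 1" using G.ord_ge_1[OF fin' g(1)] .
  moreover have "G.ord g \<le> ?n" using G.ord_le_group_order[OF fin' g(1)] .
  ultimately have ordg: "G.ord g = ?n" by simp
  obtain k where k: "?n = p * k" using pn by blast
  have "k \<noteq> 0" using k n0 by auto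
  hence "G.ord (g [^] k) = p"
    using G.ord_pow[OF g(1), of k] ordg k by simp
  hence "\<exists>a\<in>carrier (mult_of R). G.ord a = p" using G.nat_pow_closed[OF g(1)] by blast
  hence "card {a \<in> carrier (mult_of R). G.ord a = p} = phi' p"
    by (rule num_elems_of_ord_eq_phi'[OF fin pn])
  also have "phi' p = p - 1"
  proof -
    have "coprime x p" if "1 \<le> x" "x < p" for x
      using that p by (metis coprime_commute prime_imp_coprime nat_dvd_not_less less_le_trans zero_less_one)
    hence "{x. 1 \<le> x \<and> x \<le> p \<and> coprime x p} = {1..<p}"
      using p1 by (auto simp: le_less)
    thus ?thesis by (simp add: phi'_def)
  qed
  finally have *: "card {a \<in> carrier (mult_of R). G.ord a = p} = p - 1" .
  have "{x \<in> carrier R. x [^] p = \<one>} = insert \<one> {a \<in> carrier (mult_of R). G.ord a = p}"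
  proof (intro equalityI subsetI)
    fix x assume x: "x \<in> {x \<in> carrier R. x [^] p = \<one>}"
    have "x \<noteq> \<zero>" using x p1 by (auto simp: nat_pow_zero)
    hence xG: "x \<in> carrier (mult_of R)" using x by (simp add: mult_of_simps)
    hence "G.ord x dvd p" using x G.pow_eq_id by auto
    hence "G.ord x = 1 \<or> G.ord x = p" using p by (simp add: prime_nat_iff)
    thus "x \<in> insert \<one> {a \<in> carrier (mult_of R). G.ord a = p}"
      using xG G.ord_eq_1 by auto
  next
    fix x assume x: "x \<in> insert \<one> {a \<in> carrier (mult_of R). G.ord a = p}"
    show "x \<in> {x \<in> carrier R. x [^] p = \<one>}"
    proof (cases "x = \<one>")
      case False
      hence "x \<in> carrier (mult_of R)" "G.ord x = p" using x by auto
      thus ?thesis using G.pow_eq_id[of x p] by (simp add: mult_of_simps)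
    qed simp
  qed
  moreover have "\<one> \<notin> {a \<in> carrier (mult_of R). G.ord a = p}" using p1 G.ord_id by auto
  ultimately show ?thesis using * fin' p1 by (simp add: card_insert_if)
qed

section \<open>The residue ring of Z[sqrt 2] modulo q\<close>

lemma zred_mult_left [simp]: "zred m (zred m z * w) = zred m (z * w)"
  unfolding zred_eq_iff by (intro zcong_mult) auto

lemma zred_mult_right [simp]: "zred m (z * zred m w) = zred m (z * w)"
  unfolding zred_eq_iff by (intro zcong_mult) auto

lemma zred_add_left [simp]: "zred m (zred m z + w) = zred m (z + w)"
  unfolding zred_eq_iff by (intro zcong_add) auto

lemma zred_add_right [simp]: "zred m (z + zred m w) = zred m (z + w)"
  unfolding zred_eq_iff by (intro zcong_add) auto

lemma zred_zbox [simp]: "z \<in> zbox m \<Longrightarrow> zred m z = z"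
  by (simp add: zred_def zbox_def zsqrt2.expand)

text \<open>The quotient by \<open>q\<close> on box representatives, as a record to which facts
  about finite fields apply; it is F_q(sqrt 2) when 2 is not a square modulo
  \<open>q\<close>.\<close>

definition zfield :: "nat \<Rightarrow> zsqrt2 ring" where
  "zfield q = \<lparr>carrier = zbox q, monoid.mult = \<lambda>z w. zred q (z * w), one = 1,
     zero = 0, add = \<lambda>z w. zred q (z + w)\<rparr>"

lemma cring_zfield:
  assumes "q > 1"
  shows "cring (zfield q)"
proof (rule cringI)
  have [simp]: "0 \<in> zbox q" "1 \<in> zbox q" using assms by (simp_all add: zbox_def)
  have q0: "q > 0" using assms by simp
  show "abelian_group (zfield q)"
  proof (rule abelian_groupI)
    fix x assume "x \<in> carrier (zfield q)"
    have "zred q (zred q (- x) + x) = 0" by simp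
    thus "\<exists>y\<in>carrier (zfield q). y \<oplus>\<^bsub>zfield q\<^esub> x = \<zero>\<^bsub>zfield q\<^esub>"
      using q0 by (auto simp: zfield_def intro!: bexI[of _ "zred q (- x)"])
  qed (use q0 in \<open>simp_all add: zfield_def add_ac\<close>)
  show "comm_monoid (zfield q)"
    by (rule comm_monoidI) (use q0 in \<open>simp_all add: zfield_def mult_ac\<close>)
qed (simp add: zfield_def algebra_simps)

text \<open>The inverse is the conjugate divided by the norm \<open>N\<close>. If \<open>q\<close>
  divided \<open>N\<close>, then either both coordinates of \<open>z\<close> would vanish or their
  quotient would be a square root of 2.\<close>

lemma field_zfield:
  assumes q: "prime q" and nonres: "\<not> QuadRes (int q) 2"
  shows "field (zfield q)"
proof -
  have q1: "q > 1" using q prime_gt_1_nat by blast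
  interpret cring "zfield q" using cring_zfield[OF q1] .
  have unit: "\<exists>w\<in>zbox q. zred q (w * z) = 1" if z: "z \<in> zbox q" "z \<noteq> 0" for z
  proof -
    define N where "N = zre z ^ 2 - 2 * zim z ^ 2"
    have "\<not> int q dvd N"
    proof
      assume N: "int q dvd N"
      show False
      proof (cases "int q dvd zim z")
        case True
        hence "int q dvd 2 * zim z ^ 2" by (simp add: power2_eq_square)
        hence "int q dvd N + 2 * zim z ^ 2" using N by (rule dvd_add[rotated])
        hence "int q dvd zre z ^ 2" by (simp add: N_def)
        hence "int q dvd zre z" using q prime_dvd_power by (metis prime_nat_int_transfer)
        hence "zcong (int q) z 0" using True by (simp add: zcong_def cong_0_iff)
        thus False using z q1 zcong_zbox_eq[of q z 0] by (simp add: zbox_def)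
      next
        case False
        hence "coprime (zim z) (int q)"
          using q by (metis coprime_commute prime_imp_coprime prime_nat_int_transfer)
        then obtain i where i: "[zim z * i = 1] (mod int q)" using cong_solve_coprime_int by blast
        have "[zre z ^ 2 = 2 * zim z ^ 2] (mod int q)" using N by (simp add: N_def cong_iff_dvd_diff)
        hence "[zre z ^ 2 * i ^ 2 = 2 * zim z ^ 2 * i ^ 2] (mod int q)" by (rule cong_scalar_right)
        moreover have "2 * zim z ^ 2 * i ^ 2 = 2 * (zim z * i) ^ 2" by (simp add: power_mult_distrib)
        moreover have "[2 * (zim z * i) ^ 2 = 2 * 1 ^ 2] (mod int q)"
          by (intro cong_scalar_left cong_pow i)
        ultimately have "[(zre z * i) ^ 2 = 2] (mod int q)"
          by (metis cong_trans mult.right_neutral power_mult_distrib power_one)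
        thus False using nonres by (auto simp: QuadRes_def)
      qed
    qed
    hence "coprime N (int q)"
      using q by (metis coprime_commute prime_imp_coprime prime_nat_int_transfer)
    then obtain i where i: "[N * i = 1] (mod int q)" using cong_solve_coprime_int by blast
    let ?w = "ZS (zre z * i) (- zim z * i)"
    have "?w * z = of_int (N * i)"
      by (simp add: zsqrt2.expand N_def power2_eq_square algebra_simps del: of_int_mult of_int_diff)
    moreover have "zcong (int q) (of_int (N * i)) (of_int 1)" using i by (simp only: zcong_of_int_iff)
    ultimately have "zred q (zred q ?w * z) = zred q 1" by (simp add: zred_eq_iff)
    also have "zred q 1 = 1" using q1 by (simp add: zred_def one_zsqrt2_def)
    finally show ?thesis using q1 by (intro bexI[of _ "zred q ?w"]) simp_all
  qed
  have "Units (zfield q) = carrier (zfield q) - {\<zero>\<^bsub>zfield q\<^esub>}"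
  proof (intro equalityI subsetI)
    fix z assume z: "z \<in> Units (zfield q)"
    have "\<zero>\<^bsub>zfield q\<^esub> \<noteq> \<one>\<^bsub>zfield q\<^esub>" by (simp add: zfield_def zero_zsqrt2_def one_zsqrt2_def)
    hence "z \<noteq> \<zero>\<^bsub>zfield q\<^esub>"
      using z Units_closed Units_r_inv Units_inv_closed l_null by metis
    thus "z \<in> carrier (zfield q) - {\<zero>\<^bsub>zfield q\<^esub>}"
      using z Units_closed by simp
  next
    fix z assume "z \<in> carrier (zfield q) - {\<zero>\<^bsub>zfield q\<^esub>}"
    hence z: "z \<in> zbox q" "z \<noteq> 0" by (auto simp: zfield_def)
    then obtain w where "w \<in> zbox q" "zred q (w * z) = 1" using unit by blast
    moreover from this have "zred q (z * w) = 1" by (simp only: mult.commute)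
    ultimately show "z \<in> Units (zfield q)" using z by (auto simp: Units_def zfield_def)
  qed
  thus ?thesis by (rule cring_fieldI)
qed

lemma zfield_pow:
  assumes "q > 1"
  shows "z [^]\<^bsub>zfield q\<^esub> (n::nat) = zred q (z ^ n)"
proof (induction n)
  case 0
  thus ?case using assms by (simp add: zfield_def zred_def one_zsqrt2_def)
next
  case (Suc n)
  thus ?case by (simp add: zfield_def mult.commute)
qed

lemma card_roots_of_unity_inert:
  assumes q: "prime q" and nonres: "\<not> QuadRes (int q) 2" and p: "prime p" "p dvd q ^ 2 - 1"
  shows "card {z \<in> zbox q. zcong (int q) (z ^ p) 1} = p"
proof -
  have q1: "q > 1" using q prime_gt_1_nat by blast
  interpret field "zfield q" using field_zfield[OF q nonres] .
  have "zred q 1 = 1" using q1 by (simp add: zred_def one_zsqrt2_def)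
  hence "zcong (int q) (z ^ p) 1 \<longleftrightarrow> z [^]\<^bsub>zfield q\<^esub> p = \<one>\<^bsub>zfield q\<^esub>" for z
    unfolding zfield_pow[OF q1] by (simp add: zfield_def flip: zred_eq_iff)
  moreover have "carrier (zfield q) = zbox q" by (simp add: zfield_def)
  ultimately show ?thesis
    using card_roots_of_unity_prime[of p] p by (simp add: card_zbox)
qed

section \<open>The inert case\<close>

text \<open>The instances used are \<open>lin_form 1 1\<close>, which is \<open>coeff_sum\<close>,
  \<open>lin_form 0 1\<close>, the second coordinate, and \<open>lin_form 0 0\<close>, which makes a
  vanishing condition void.\<close>

definition lin_form :: "int \<Rightarrow> int \<Rightarrow> zsqrt2 \<Rightarrow> int" where
  "lin_form a b z = a * zre z + b * zim z"

lemma lin_form_scale: "lin_form a b (of_int l * z) = l * lin_form a b z"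
  by (simp add: lin_form_def algebra_simps)

lemma lin_form_cong: "zcong m z w \<Longrightarrow> [lin_form a b z = lin_form a b w] (mod m)"
  by (simp add: lin_form_def zcong_def cong_add cong_scalar_left)

text \<open>Scaling \<open>z\<close> by \<open>l\<close> multiplies both functionals of
  \<open>z ^ p\<close> by \<open>l ^ p\<close>, and \<open>p\<close>-th powers permute the units of
  F_q. So each point of the left-hand set is a unique unit multiple of a point where the second
  functional is 1.\<close>

lemma card_scaling:
  assumes q: "prime q" and cop: "coprime p (q - 1)" and p0: "p > 0"
  shows "card {z \<in> zbox q. [lin_form c d (z ^ p) = 0] (mod int q) \<and> \<not> [lin_form a b (z ^ p) = 0] (mod int q)} =
    (q - 1) * card {z \<in> zbox q. [lin_form c d (z ^ p) = 0] (mod int q) \<and> [lin_form a b (z ^ p) = 1] (mod int q)}"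
    (is "card ?T = _ * card ?U")
proof -
  have q1: "q > 1" using q prime_gt_1_nat by blast
  obtain m k where mk: "p * m = 1 + k * (q - 1)"
    using coprime_inverse_exponent[OF cop] q1 p0 by auto
  have root: "[(x ^ p) ^ m = x] (mod int q)" for x
    unfolding power_mult[symmetric] mk cong_iff_dvd_diff
    by (rule dvd_power_period) (use fermat_cong_int[OF q, of x] q1 in \<open>simp add: cong_iff_dvd_diff\<close>)
  have inverse: "\<exists>i. [l * i = 1] (mod int q)" if "\<not> [l = 0] (mod int q)" for l
  proof -
    have "coprime l (int q)"
      using q that by (metis cong_0_iff coprime_commute prime_imp_coprime prime_nat_int_transfer)
    thus ?thesis using cong_solve_coprime_int by blast
  qed
  have scaled: "[lin_form x y (zred q (of_int l * z) ^ p) = l ^ p * e] (mod int q)"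
    if "[lin_form x y (z ^ p) = e] (mod int q)" for x y l z e
  proof -
    have "[lin_form x y (zred q (of_int l * z) ^ p) = lin_form x y ((of_int l * z) ^ p)] (mod int q)"
      by (intro lin_form_cong zcong_power zcong_zred)
    also have "lin_form x y ((of_int l * z) ^ p) = l ^ p * lin_form x y (z ^ p)"
      by (simp only: power_scale lin_form_scale)
    also have "[\<dots> = l ^ p * e] (mod int q)" using that by (rule cong_scalar_left)
    finally show ?thesis .
  qed
  have unit_iff: "\<not> [l = 0] (mod int q)" if "l \<in> {1..<int q}" for l
    using that by (simp add: cong_def)
  define f where "f = (\<lambda>(l, z). zred q (of_int l * z))"
  have "f ` ({1..<int q} \<times> ?U) = ?T"
  proof (intro equalityI subsetI)
    fix y assume "y \<in> f ` ({1..<int q} \<times> ?U)"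
    then obtain l z where lz: "l \<in> {1..<int q}" "z \<in> ?U" "y = zred q (of_int l * z)"
      by (auto simp: f_def)
    have "[lin_form c d (y ^ p) = l ^ p * 0] (mod int q)"
      using scaled[of c d z 0 l] lz by simp
    moreover have y1: "[lin_form a b (y ^ p) = l ^ p * 1] (mod int q)"
      using scaled[of a b z 1 l] lz by simp
    have "\<not> [lin_form a b (y ^ p) = 0] (mod int q)"
    proof
      assume "[lin_form a b (y ^ p) = 0] (mod int q)"
      hence "[l ^ p = 0] (mod int q)" using y1 by (metis cong_sym cong_trans mult.right_neutral)
      hence "int q dvd l" using q by (metis cong_0_iff prime_dvd_power prime_nat_int_transfer)
      thus False using unit_iff[OF lz(1)] by (simp add: cong_0_iff)
    qed
    ultimately show "y \<in> ?T" using lz q1 by simp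
  next
    fix y assume y: "y \<in> ?T"
    define e where "e = lin_form a b (y ^ p)"
    \<comment> \<open>This is the \<open>p\<close>-th root of \<open>e\<close> modulo
      \<open>q\<close>; dividing \<open>y\<close> by it normalises the value to 1.\<close>
    define l where "l = e ^ m mod int q"
    have "[l ^ p = (e ^ m) ^ p] (mod int q)" by (intro cong_pow) (simp add: l_def)
    also have "(e ^ m) ^ p = (e ^ p) ^ m" by (simp only: mult.commute flip: power_mult)
    also have "[(e ^ p) ^ m = e] (mod int q)" by (rule root)
    finally have lp: "[l ^ p = e] (mod int q)" .
    have e0: "\<not> [e = 0] (mod int q)" using y by (simp add: e_def)
    have "l \<noteq> 0"
    proof
      assume "l = 0"
      thus False using cong_sym[OF lp] e0 p0 by (simp add: power_0_left)
    qed
    moreover have "0 \<le> l" "l < int q" using q1 by (simp_all add: l_def)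
    ultimately have l: "l \<in> {1..<int q}" by simp
    obtain i where i: "[l * i = 1] (mod int q)" using inverse[OF unit_iff[OF l]] by blast
    define z where "z = zred q (of_int i * y)"
    have "[lin_form c d (z ^ p) = i ^ p * 0] (mod int q)"
      using scaled[of c d y 0 i] y by (simp add: z_def)
    moreover have "[lin_form a b (z ^ p) = 1] (mod int q)"
    proof -
      have "[lin_form a b (z ^ p) = i ^ p * e] (mod int q)"
        using scaled[of a b y e i] by (simp add: z_def e_def)
      also have "[i ^ p * e = i ^ p * l ^ p] (mod int q)"
        by (intro cong_scalar_left cong_sym[OF lp])
      also have "i ^ p * l ^ p = (l * i) ^ p" by (simp add: power_mult_distrib mult.commute)
      also have "[(l * i) ^ p = 1 ^ p] (mod int q)" using i by (rule cong_pow)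
      finally show ?thesis by simp
    qed
    ultimately have "z \<in> ?U" using q1 by (simp add: z_def)
    moreover have "y = f (l, z)"
    proof -
      have "f (l, z) = zred q (of_int (l * i) * y)" by (simp add: f_def z_def mult.assoc)
      also have "\<dots> = zred q (of_int 1 * y)"
        unfolding zred_eq_iff by (intro zcong_mult zcong_refl) (simp only: zcong_of_int_iff i)
      finally show ?thesis using y by simp
    qed
    ultimately show "y \<in> f ` ({1..<int q} \<times> ?U)" using l by blast
  qed
  moreover have "inj_on f ({1..<int q} \<times> ?U)"
  proof (rule inj_onI)
    fix x x' assume xx: "x \<in> {1..<int q} \<times> ?U" "x' \<in> {1..<int q} \<times> ?U" "f x = f x'"
    obtain l z l' z' where x: "x = (l, z)" "x' = (l', z')" by (metis surj_pair)
    have l: "l \<in> {1..<int q}" "l' \<in> {1..<int q}" and z: "z \<in> ?U" "z' \<in> ?U" using xx x by auto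
    have eq: "zred q (of_int l * z) = zred q (of_int l' * z')" using xx x by (simp add: f_def)
    \<comment> \<open>The value at the scaled point is \<open>l ^ p\<close>, which determines
      \<open>l\<close> and then \<open>z\<close>.\<close>
    have val: "[lin_form a b (zred q (of_int l * z) ^ p) = l ^ p] (mod int q)" if "z \<in> ?U" for l z
      using scaled[of a b z 1 l] that by simp
    have "[l ^ p = l' ^ p] (mod int q)"
      using val[OF z(1), of l] val[OF z(2), of l'] unfolding eq by (meson cong_sym cong_trans)
    hence "[(l ^ p) ^ m = (l' ^ p) ^ m] (mod int q)" by (rule cong_pow)
    hence "[l = l'] (mod int q)" using root by (meson cong_sym cong_trans)
    hence ll: "l = l'" using l by (simp add: cong_def)
    obtain i where i: "[l * i = 1] (mod int q)" using inverse[OF unit_iff[OF l(1)]] by blast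
    have unscale: "zcong (int q) (of_int i * (of_int l * w)) w" for w
    proof -
      have "of_int i * (of_int l * w) = of_int (l * i) * w" by (simp add: mult_ac)
      also have "zcong (int q) \<dots> (of_int 1 * w)"
        by (intro zcong_mult zcong_refl) (simp only: zcong_of_int_iff i)
      finally show ?thesis by simp
    qed
    have "zcong (int q) (of_int i * (of_int l * z)) (of_int i * (of_int l * z'))"
      by (rule zcong_mult[OF zcong_refl]) (use eq ll in \<open>simp add: zred_eq_iff\<close>)
    hence "zcong (int q) z z'" using unscale by (meson zcong_sym zcong_trans)
    hence "z = z'" using z zcong_zbox_eq by blast
    thus "x = x'" using x ll by simp
  qed
  ultimately have "bij_betw f ({1..<int q} \<times> ?U) ?T" by (intro bij_betw_imageI)
  hence "card ?T = card ({1..<int q} \<times> ?U)" by (rule bij_betw_same_card[symmetric])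
  thus ?thesis using q1 by (simp add: card_cartesian_product nat_diff_distrib)
qed

text \<open>The \<open>q ^ 2 - 1\<close> nonzero residues split according to whether
  \<open>coeff_sum (z ^ p)\<close> vanishes. By scaling, both parts are \<open>q - 1\<close> times a
  normalised set: the solutions, and the \<open>z\<close> with \<open>z ^ p\<close> equal to sqrt 2
  - 1.\<close>

lemma N_count_inert:
  assumes q: "prime q" "odd q" and cop: "coprime p (q - 1)" and p: "p > 0" "p \<le> q ^ 2"
  shows "N_count p q + card {z \<in> zbox q. zcong (int q) (z ^ p) (ZS (-1) 1)} = q + 1"
proof -
  have q1: "q > 1" using q prime_gt_1_nat by blast
  let ?A = "{z \<in> zbox q. \<not> [coeff_sum (z ^ p) = 0] (mod int q)}"
  let ?B = "{z \<in> zbox q. [coeff_sum (z ^ p) = 0] (mod int q) \<and> \<not> [zim (z ^ p) = 0] (mod int q)}"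
  let ?U = "{z \<in> zbox q. zcong (int q) (z ^ p) (ZS (-1) 1)}"
  have cardA: "card ?A = (q - 1) * N_count p q"
    using card_scaling[OF q(1) cop p(1), of 0 0 1 1]
    by (simp add: N_count_eq lin_form_def coeff_sum_def)
  have cardB: "card ?B = (q - 1) * card ?U"
  proof -
    have "[x + y = 0] (mod int q) \<and> [y = 1] (mod int q) \<longleftrightarrow>
        [x = - 1] (mod int q) \<and> [y = 1] (mod int q)" for x y
    proof -
      have "[x + y = 0] (mod int q) \<longleftrightarrow> [x = - 1] (mod int q)" if "[y = 1] (mod int q)"
      proof -
        have "[x + y = x + 1] (mod int q)" by (intro cong_add cong_refl that)
        hence "[x + y = 0] (mod int q) \<longleftrightarrow> [x + 1 = 0] (mod int q)" by (meson cong_sym cong_trans)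
        thus ?thesis by (simp add: cong_iff_dvd_diff)
      qed
      thus ?thesis by blast
    qed
    hence "[coeff_sum (z ^ p) = 0] (mod int q) \<and> [zim (z ^ p) = 1] (mod int q) \<longleftrightarrow>
        zcong (int q) (z ^ p) (ZS (-1) 1)" for z
      by (simp add: coeff_sum_def zcong_def)
    thus ?thesis
      using card_scaling[OF q(1) cop p(1), of 1 1 0 1] by (simp add: lin_form_def coeff_sum_def)
  qed
  have "zbox q = insert 0 (?A \<union> ?B)"
  proof (intro equalityI subsetI)
    fix z assume z: "z \<in> zbox q"
    \<comment> \<open>If \<open>z ^ p\<close> vanishes, so does \<open>z ^ (q ^ 2)\<close>, which is
      \<open>z\<close> itself.\<close>
    have "z = 0" if *: "[coeff_sum (z ^ p) = 0] (mod int q)" "[zim (z ^ p) = 0] (mod int q)"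
    proof -
      have "[zre (z ^ p) = 0] (mod int q)"
        using cong_diff[OF *] by (simp add: coeff_sum_def)
      hence "zcong (int q) (z ^ p) 0" using * by (simp add: zcong_def)
      hence "zcong (int q) (z ^ p * z ^ (q ^ 2 - p)) (0 * z ^ (q ^ 2 - p))"
        by (intro zcong_mult zcong_refl)
      hence "zcong (int q) (z ^ (q ^ 2)) 0" using p(2) by (simp flip: power_add)
      hence "zcong (int q) z 0" using zcong_frobenius_square[OF q] by (meson zcong_sym zcong_trans)
      thus ?thesis using z q1 zcong_zbox_eq[of q z 0] by (simp add: zbox_def)
    qed
    thus "z \<in> insert 0 (?A \<union> ?B)" using z by blast
  next
    fix z assume "z \<in> insert 0 (?A \<union> ?B)"
    thus "z \<in> zbox q" using q1 by (auto simp: zbox_def)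
  qed
  hence "q ^ 2 = card (insert 0 (?A \<union> ?B))" using card_zbox[of q] by (simp only:)
  also have "0 \<notin> ?A \<union> ?B" using p by (simp add: power_0_left coeff_sum_def)
  hence "card (insert 0 (?A \<union> ?B)) = Suc (card (?A \<union> ?B))" by (intro card_insert_disjoint) auto
  also have "card (?A \<union> ?B) = card ?A + card ?B" by (intro card_Un_disjoint) auto
  finally have "q ^ 2 = Suc ((q - 1) * N_count p q + (q - 1) * card ?U)"
    by (simp only: cardA cardB)
  moreover have "q ^ 2 = Suc ((q - 1) * (q + 1))"
    using q1 by (cases q) (auto simp: power2_eq_square)
  ultimately have "(q - 1) * (N_count p q + card ?U) = (q - 1) * (q + 1)"
    by (simp only: Suc_inject distrib_left)
  thus ?thesis using q1 unfolding mult_cancel1 by auto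
qed

text \<open>Multiplication by the inverse of one \<open>p\<close>-th root \<open>u\<close> of
  \<open>a\<close> carries the fibre over \<open>a\<close> to the fibre over 1.\<close>

lemma card_power_fiber:
  assumes q: "q > 1" and p: "p > 0" and ab: "a * b = 1" and u: "zcong (int q) (u ^ p) a"
  shows "card {z \<in> zbox q. zcong (int q) (z ^ p) a} = card {z \<in> zbox q. zcong (int q) (z ^ p) 1}"
proof -
  let ?U = "{z \<in> zbox q. zcong (int q) (z ^ p) a}" and ?K = "{z \<in> zbox q. zcong (int q) (z ^ p) 1}"
  \<comment> \<open>An explicit inverse of \<open>u\<close>: the product \<open>u * v\<close> is
    \<open>u ^ p * b\<close>, congruent to \<open>a * b = 1\<close>.\<close>
  define v where "v = u ^ (p - 1) * b"
  have "u * v = u ^ p * b" using p by (simp add: v_def power_eq_if mult_ac)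
  also have "zcong (int q) \<dots> (a * b)" using u by (intro zcong_mult zcong_refl)
  finally have uv: "zcong (int q) (u * v) 1" by (simp add: ab)
  have "zcong (int q) (a * v ^ p) (u ^ p * v ^ p)" by (rule zcong_mult[OF zcong_sym[OF u] zcong_refl])
  also have "u ^ p * v ^ p = (u * v) ^ p" by (simp add: power_mult_distrib)
  also have "zcong (int q) \<dots> (1 ^ p)" using uv by (rule zcong_power)
  finally have av: "zcong (int q) (a * v ^ p) 1" by simp
  have q0: "q > 0" using q by simp
  have inv: "zred q (zred q (z * x) * y) = z" if "z \<in> zbox q" "zcong (int q) (x * y) 1" for z x y
  proof -
    have "zred q (zred q (z * x) * y) = zred q (z * (x * y))" by (simp add: mult.assoc)
    also have "\<dots> = zred q (z * 1)" unfolding zred_eq_iff using that by (intro zcong_mult zcong_refl)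
    finally show ?thesis using that by simp
  qed
  have pow: "zcong (int q) (zred q (z * x) ^ p) (c * d)"
    if "zcong (int q) (z ^ p) c" "zcong (int q) (x ^ p) d" for z x c d
  proof -
    have "zcong (int q) (zred q (z * x) ^ p) ((z * x) ^ p)" by (intro zcong_power zcong_zred)
    also have "(z * x) ^ p = z ^ p * x ^ p" by (rule power_mult_distrib)
    also have "zcong (int q) \<dots> (c * d)" using that by (rule zcong_mult)
    finally show ?thesis .
  qed
  have "bij_betw (\<lambda>z. zred q (z * v)) ?U ?K"
  proof (rule bij_betw_byWitness[where f' = "\<lambda>z. zred q (z * u)"])
    show "\<forall>z\<in>?U. zred q (zred q (z * v) * u) = z"
      using inv[of _ v u] uv by (simp add: mult.commute)
    show "\<forall>z\<in>?K. zred q (zred q (z * u) * v) = z" using inv[of _ u v] uv by simp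
    show "(\<lambda>z. zred q (z * v)) ` ?U \<subseteq> ?K"
      using q0 zcong_trans[OF pow[OF _ zcong_refl] av] by auto
    show "(\<lambda>z. zred q (z * u)) ` ?K \<subseteq> ?U"
      using q0 pow[OF _ u, of _ 1] by auto
  qed
  thus ?thesis by (rule bij_betw_same_card)
qed

section \<open>The unit 1 + sqrt 2 and its inverse\<close>

lemma zcong_power_inverse:
  assumes xy: "x * y = 1" and per: "zcong m (x ^ Q) x" and Q: "Q \<ge> 2"
  shows "zcong m (x ^ (Q - 2)) y"
proof -
  have "x ^ (Q - 2) = x ^ (Q - 2) * (x * y) ^ 2" by (simp add: xy)
  also have "\<dots> = x ^ (Q - 2 + 2) * y ^ 2" by (simp only: power_add power_mult_distrib mult.assoc)
  also have "\<dots> = x ^ Q * y ^ 2" using Q by (simp only: le_add_diff_inverse2)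
  also have "zcong m \<dots> (x * y ^ 2)" using per by (intro zcong_mult zcong_refl)
  also have "x * y ^ 2 = y" using xy by (simp add: power2_eq_square flip: mult.assoc)
  finally show ?thesis .
qed

text \<open>The inverse \<open>b\<close> is a power of \<open>a\<close> modulo \<open>q\<close>,
  hence again a \<open>p\<close>-th power. This passes between 1 + sqrt 2 and its inverse sqrt 2 -
  1.\<close>

lemma power_value_inverse:
  assumes q: "prime q" "odd q" and ab: "a * b = 1" and z: "zcong (int q) (z ^ p) a"
  shows "\<exists>w. zcong (int q) (w ^ p) b"
proof -
  have "q ^ 2 \<ge> 2" using prime_ge_2_nat[OF q(1)] self_le_power[of q 2] by simp
  hence "zcong (int q) (a ^ (q ^ 2 - 2)) b"
    by (intro zcong_power_inverse[OF ab] zcong_frobenius_square q)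
  moreover have "zcong (int q) ((z ^ p) ^ (q ^ 2 - 2)) (a ^ (q ^ 2 - 2))"
    using z by (rule zcong_power)
  moreover have "(z ^ p) ^ (q ^ 2 - 2) = (z ^ (q ^ 2 - 2)) ^ p"
    by (simp only: mult.commute flip: power_mult)
  ultimately show ?thesis using zcong_trans by metis
qed

text \<open>Reducing after every multiplication or once at the end gives the same pair, so the pairs
  of the statement follow powers in Z[sqrt 2].\<close>

lemma qs2_pow_eq: "qs2_pow m (x, y) n = (zre (ZS x y ^ n) mod m, zim (ZS x y ^ n) mod m)"
proof (induction n)
  case (Suc n)
  have "(x * (a mod m) + 2 * y * (b mod m)) mod m = (x * a + 2 * y * b) mod m"
    "(x * (b mod m) + y * (a mod m)) mod m = (x * b + y * a) mod m" for a b
    unfolding cong_def[symmetric] by (intro cong_add cong_mult cong_refl; simp)+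
  thus ?case by (simp add: Suc qs2_mult_def)
qed simp

lemma one_plus_sqrt2_is_pth_power_iff:
  "one_plus_sqrt2_is_pth_power p q \<longleftrightarrow> (\<exists>z. zcong (int q) (z ^ p) (ZS 1 1))"
proof -
  have "one_plus_sqrt2_is_pth_power p q \<longleftrightarrow> (\<exists>x y. zcong (int q) (ZS x y ^ p) (ZS 1 1))"
    by (simp add: one_plus_sqrt2_is_pth_power_def qs2_pow_eq zcong_def cong_def)
  thus ?thesis by (metis zsqrt2.collapse)
qed

lemma root2_units: "ZS 1 1 * ZS (-1) 1 = 1" "ZS (-1) 1 * ZS 1 1 = 1"
  by (simp_all add: zsqrt2.expand)

text \<open>The fibre over sqrt 2 - 1 is empty or a translate of the \<open>p\<close>-th roots of
  unity, of which there are \<open>p\<close> because \<open>p\<close> divides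
  \<open>q ^ 2 - 1\<close>.\<close>

lemma N_count_inert_cases:
  assumes p: "prime p" "odd p" and q: "prime q" and pq: "p dvd q + 1"
    and leg: "Legendre 2 (int q) = -1"
  shows "\<not> one_plus_sqrt2_is_pth_power p q \<Longrightarrow> N_count p q = q + 1"
    and "one_plus_sqrt2_is_pth_power p q \<Longrightarrow> N_count p q + p = q + 1"
proof -
  have nonres: "\<not> QuadRes (int q) 2" and "\<not> [2 = 0] (mod int q)"
    using leg by (auto simp: Legendre_def split: if_splits)
  hence "q \<noteq> 2" by (auto simp: cong_def)
  hence oddq: "odd q" using q by (metis primes_dvd_imp_eq two_is_prime_nat)
  have q1: "q > 1" and p1: "p > 1" using p q prime_gt_1_nat by auto
  \<comment> \<open>Otherwise \<open>p\<close> would divide the difference 2 of \<open>q + 1\<close>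
    and \<open>q - 1\<close>, against its being odd.\<close>
  have "\<not> p dvd q - 1"
  proof
    assume "p dvd q - 1"
    hence "p dvd (q + 1) - (q - 1)" by (rule dvd_diff_nat[OF pq])
    hence "p dvd 2" using q1 by simp
    hence "p = 2" using p(1) primes_dvd_imp_eq two_is_prime_nat by blast
    thus False using p(2) by simp
  qed
  hence cop: "coprime p (q - 1)" using p(1) by (rule prime_imp_coprime[rotated])
  have sq: "q ^ 2 - 1 = (q - 1) * (q + 1)" using q1 by (cases q) (auto simp: power2_eq_square)
  have "p \<le> q + 1" using pq by (intro dvd_imp_le) auto
  also have "q + 1 \<le> q ^ 2" using q1 by (cases q) (auto simp: power2_eq_square)
  finally have ple: "p \<le> q ^ 2" .
  let ?U = "{z \<in> zbox q. zcong (int q) (z ^ p) (ZS (-1) 1)}"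
  have main: "N_count p q + card ?U = q + 1"
    using N_count_inert[OF q oddq cop _ ple] p1 by simp
  {
    assume *: "\<not> one_plus_sqrt2_is_pth_power p q"
    have "?U = {}"
      using * power_value_inverse[OF q oddq root2_units(2), of _ p]
      by (auto simp: one_plus_sqrt2_is_pth_power_iff)
    hence "card ?U = 0" by (simp only: card.empty)
    thus "N_count p q = q + 1" using main by (simp only: add_0_right)
  next
    assume "one_plus_sqrt2_is_pth_power p q"
    then obtain u where u: "zcong (int q) (u ^ p) (ZS (-1) 1)"
      using power_value_inverse[OF q oddq root2_units(1), of _ p]
      by (auto simp: one_plus_sqrt2_is_pth_power_iff)
    have "card ?U = card {z \<in> zbox q. zcong (int q) (z ^ p) 1}"
      by (rule card_power_fiber[OF q1 _ root2_units(2) u]) (use p1 in simp)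
    also have "\<dots> = p"
      by (rule card_roots_of_unity_inert[OF q nonres p(1)]) (simp only: sq dvd_mult[OF pq])
    finally show "N_count p q + p = q + 1" using main by simp
  }
qed

section \<open>The count modulo all prime powers\<close>

theorem theorem10p1:
  fixes p q :: nat
  assumes "prime p" and "odd p" and "prime q"
  shows
   "(\<forall>s\<ge>1.
       ((q \<notin> {p, 2} \<and> \<not> [int q = 1] (mod int p) \<and> \<not> [int q = -1] (mod int p))
        \<or> ([int q = -1] (mod int p) \<and> Legendre 2 (int q) = 1)
        \<or> (q = p \<and> s = 1))
       \<longrightarrow> N_count p (q ^ s) = q ^ s)
    \<and> (\<forall>s\<ge>1. [int q = -1] (mod int p) \<and> Legendre 2 (int q) = -1 \<longrightarrow>
         (\<not> one_plus_sqrt2_is_pth_power p q \<longrightarrow>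
            int (N_count p (q ^ s)) = int q ^ s + int q ^ (s - 1))
       \<and> (one_plus_sqrt2_is_pth_power p q \<longrightarrow>
            int (N_count p (q ^ s)) = int q ^ s + (1 - int p) * int q ^ (s - 1)))
    \<and> (\<forall>s\<ge>1. q = 2 \<longrightarrow> N_count p (q ^ s) = 2 ^ (s - 1))
    \<and> ([int q = 1] (mod int p) \<longrightarrow>
         (\<exists>d::nat. d > 0 \<and> (\<forall>s\<ge>1. N_count p (q ^ s) = p * q ^ (s - 1) * d)))
    \<and> (q = p \<longrightarrow>
         (\<exists>d::nat. d > 0 \<and> (\<forall>s>1. N_count p (q ^ s) = p * q ^ (s - 1) * d)))"
proof (intro conjI)
  have p1: "p > 1" and q1: "q > 1" using assms prime_gt_1_nat by auto
  have cong1: "[int q = 1] (mod int p) \<longleftrightarrow> p dvd q - 1"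
    using q1 by (simp add: cong_iff_dvd_diff of_nat_diff flip: of_nat_dvd_iff[where 'a = int])
  have cong2: "[int q = - 1] (mod int p) \<longleftrightarrow> p dvd q + 1"
    by (simp add: cong_iff_dvd_diff add.commute flip: of_nat_dvd_iff[where 'a = int])
  have oddq: "odd q" if "q \<noteq> 2" using assms that by (metis primes_dvd_imp_eq two_is_prime_nat)
  \<comment> \<open>The symbol of 2 modulo 2 is 0.\<close>
  have leg2: "q \<noteq> 2" if "Legendre 2 (int q) \<noteq> 0"
    using that by (auto simp: Legendre_def cong_def)
  have p2: "\<not> p dvd 2" using assms by (metis primes_dvd_imp_eq two_is_prime_nat dvd_refl)
  have not_both: "\<not> p dvd q - 1" if "p dvd q + 1"
  proof
    assume "p dvd q - 1"
    hence "p dvd (q + 1) - (q - 1)" by (rule dvd_diff_nat[OF that])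
    thus False using q1 p2 by simp
  qed
  have pq: "q \<noteq> p" if "p dvd q - 1 \<or> p dvd q + 1"
  proof
    assume "q = p"
    with that have "p dvd p - 1 \<or> p dvd p + 1" by blast
    moreover have "\<not> p dvd p - 1" using p1 by (intro nat_dvd_not_less) auto
    moreover have "\<not> p dvd p + 1" using p1 dvd_add_right_iff[of p p 1] by simp
    ultimately show False by blast
  qed
  have lift: "N_count p (q ^ s) = q ^ (s - 1) * N_count p q" if "q \<noteq> p" "s \<ge> 1" for s
    using N_count_prime_power assms that by blast
  have qs: "q ^ (s - 1) * q = q ^ s" if "s \<ge> 1" for s
    using that by (intro power_minus_mult) simp
  show "\<forall>s\<ge>1.
       ((q \<notin> {p, 2} \<and> \<not> [int q = 1] (mod int p) \<and> \<not> [int q = -1] (mod int p))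
        \<or> ([int q = -1] (mod int p) \<and> Legendre 2 (int q) = 1)
        \<or> (q = p \<and> s = 1))
       \<longrightarrow> N_count p (q ^ s) = q ^ s"
  proof (intro allI impI)
    fix s :: nat assume s: "s \<ge> 1"
    assume H: "(q \<notin> {p, 2} \<and> \<not> [int q = 1] (mod int p) \<and> \<not> [int q = -1] (mod int p))
        \<or> ([int q = -1] (mod int p) \<and> Legendre 2 (int q) = 1) \<or> (q = p \<and> s = 1)"
    then consider "q \<noteq> p" "q \<noteq> 2" "\<not> p dvd q - 1" "\<not> p dvd q + 1"
      | "p dvd q + 1" "Legendre 2 (int q) = 1" | "q = p" "s = 1"
      unfolding cong1 cong2 by blast
    thus "N_count p (q ^ s) = q ^ s"
    proof cases
      case 1
      thus ?thesis using N_count_generic oddq assms lift[OF _ s] qs[OF s] by simp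
    next
      case 2
      hence "N_count p q = q" using assms oddq leg2 not_both by (intro N_count_split) auto
      thus ?thesis using 2 pq lift[OF _ s] qs[OF s] by simp
    next
      case 3
      thus ?thesis using N_count_self assms by simp
    qed
  qed
  show "\<forall>s\<ge>1. [int q = -1] (mod int p) \<and> Legendre 2 (int q) = -1 \<longrightarrow>
         (\<not> one_plus_sqrt2_is_pth_power p q \<longrightarrow>
            int (N_count p (q ^ s)) = int q ^ s + int q ^ (s - 1))
       \<and> (one_plus_sqrt2_is_pth_power p q \<longrightarrow>
            int (N_count p (q ^ s)) = int q ^ s + (1 - int p) * int q ^ (s - 1))"
  proof (intro allI impI, elim conjE)
    fix s :: nat assume s: "s \<ge> 1" and H: "[int q = -1] (mod int p)" "Legendre 2 (int q) = -1"
    have dv: "p dvd q + 1" using H(1) cong2 by simp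
    have N: "int (N_count p (q ^ s)) = int q ^ (s - 1) * int (N_count p q)"
      using lift[OF _ s] pq dv by simp
    have Q: "int q ^ s = int q ^ (s - 1) * int q"
      by (metis qs[OF s] of_nat_mult of_nat_power)
    have 1: "int (N_count p q) = int q + 1" if "\<not> one_plus_sqrt2_is_pth_power p q"
      using N_count_inert_cases(1)[OF assms dv H(2) that] by simp
    have 2: "int (N_count p q) = int q + (1 - int p)" if "one_plus_sqrt2_is_pth_power p q"
      using N_count_inert_cases(2)[OF assms dv H(2) that] by linarith
    show "(\<not> one_plus_sqrt2_is_pth_power p q \<longrightarrow>
            int (N_count p (q ^ s)) = int q ^ s + int q ^ (s - 1))
       \<and> (one_plus_sqrt2_is_pth_power p q \<longrightarrow>
            int (N_count p (q ^ s)) = int q ^ s + (1 - int p) * int q ^ (s - 1))"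
      unfolding N Q using 1 2 by (metis distrib_left mult.commute mult.right_neutral)
  qed
  show "\<forall>s\<ge>1. q = 2 \<longrightarrow> N_count p (q ^ s) = 2 ^ (s - 1)"
  proof -
    have "p \<noteq> 2" using assms(2) by auto
    thus ?thesis using lift N_count_two[OF assms(2) p1] by auto
  qed
  show "[int q = 1] (mod int p) \<longrightarrow>
         (\<exists>d::nat. d > 0 \<and> (\<forall>s\<ge>1. N_count p (q ^ s) = p * q ^ (s - 1) * d))"
  proof
    assume "[int q = 1] (mod int p)"
    hence dv: "p dvd q - 1" using cong1 by simp
    \<comment> \<open>The same \<open>d\<close> serves every \<open>s\<close>, since lifting only
      multiplies the count by \<open>q ^ (s - 1)\<close>.\<close>
    obtain d where d: "N_count p q = p * d"
      using prime_dvd_N_count[OF assms(1,3) dv] by blast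
    moreover have "d > 0" using N_count_pos[OF q1, of p] d by (cases d) auto
    ultimately show "\<exists>d::nat. d > 0 \<and> (\<forall>s\<ge>1. N_count p (q ^ s) = p * q ^ (s - 1) * d)"
      using lift pq dv by (intro exI[of _ d]) simp
  qed
  show "q = p \<longrightarrow> (\<exists>d::nat. d > 0 \<and> (\<forall>s>1. N_count p (q ^ s) = p * q ^ (s - 1) * d))"
  proof
    assume qp: "q = p"
    \<comment> \<open>Here \<open>d\<close> is \<open>sol_count p p 1 1\<close>, which is positive
      because \<open>z = 1\<close> is a solution.\<close>
    have "1 \<in> {z \<in> zbox (p ^ 1). [coeff_sum (z ^ p) = 1] (mod int p ^ (1 + 1))}"
      using p1 by (simp add: zbox_def coeff_sum_def)
    hence "sol_count p p 1 1 > 0" unfolding sol_count_def by (subst card_gt_0_iff) auto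
    thus "\<exists>d::nat. d > 0 \<and> (\<forall>s>1. N_count p (q ^ s) = p * q ^ (s - 1) * d)"
      using N_count_prime_power_self[OF assms(1,2)] qp by blast
  qed
qed

end
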